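(* For every integer $n\ge 3$, the generalized $3$-connectivity of the $n$-dimensional godan graph satisfies $\kappa_3(EA_n)=n-1$.
   Context: Let $S_n$ be the symmetric group on $\{1,\dots,n\}$, with $(ij)$ a transposition, $(123)$, $(132)$ $3$-cycles, and composition $\sigma\tau(i)=\sigma(\tau(i))$. Let $\Omega^*=\{(12),(123),(132)\}\cup\{(12)(3i): 4\le i\le n\}$. The $n$-dimensional godan graph $EA_n$ ($n\ge3$) has vertex set $S_n$, with $u,v$ adjacent iff $u=vs$ for some $s\in\Omega^*$ (i.e., it is the Cayley graph $\mathrm{Cay}(S_n,\Omega^* )$). For a graph $G$ and $S\subseteq V(G)$, an $S$-tree is a tree $T$ in $G$ with $S\subseteq V(T)$; $S$-trees $T_1,\dots,T_r$ are internally edge disjoint if $V(T_i)\cap V(T_j)=S$ and $E(T_i)\cap E(T_j)=\emptyset$ for $i\ne j$. $\kappa_G(S)$ is the maximum number of internally edge disjoint $S$-trees, and $\kappa_k(G)=\min\{\kappa_G(S): S\subseteq V(G),\ |S|=k\}$. *)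

theory Defs
  imports "HOL-Algebra.Sym_Groups"
begin

section \<open>Simple undirected graphs\<close>

text \<open>
  Edges are unordered pairs of distinct vertices. The notion of tree in the AFP entry on
  directed graphs is not used here: a symmetric digraph with an arc always contains a directed
  cycle of length 2, and the absence of directed cycles does not exclude undirected ones.
\<close>

record 'a ugraph =
  uverts :: "'a set"
  uedges :: "'a set set"

definition simple_graph :: "'a ugraph \<Rightarrow> bool" where
  "simple_graph G \<longleftrightarrow>
     (\<forall>e \<in> uedges G. \<exists>u v. e = {u, v} \<and> u \<noteq> v \<and> u \<in> uverts G \<and> v \<in> uverts G)"

definition is_subgraph :: "'a ugraph \<Rightarrow> 'a ugraph \<Rightarrow> bool" where
  "is_subgraph H G \<longleftrightarrow>
     simple_graph H \<and> uverts H \<subseteq> uverts G \<and> uedges H \<subseteq> uedges G"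

definition adj_rel :: "'a ugraph \<Rightarrow> ('a \<times> 'a) set" where
  "adj_rel G = {(u, v). {u, v} \<in> uedges G}"

definition connected_graph :: "'a ugraph \<Rightarrow> bool" where
  "connected_graph G \<longleftrightarrow>
     uverts G \<noteq> {} \<and> (\<forall>u \<in> uverts G. \<forall>v \<in> uverts G. (u, v) \<in> (adj_rel G)\<^sup>*)"

text \<open>A cycle is given by its list of at least three distinct vertices; the closing edge joins
  the last vertex to the first.\<close>

definition is_cycle :: "'a ugraph \<Rightarrow> 'a list \<Rightarrow> bool" where
  "is_cycle G c \<longleftrightarrow>
     3 \<le> length c \<and> distinct c \<and>
     (\<forall>i. Suc i < length c \<longrightarrow> {c ! i, c ! Suc i} \<in> uedges G) \<and>
     {last c, hd c} \<in> uedges G"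

definition is_tree :: "'a ugraph \<Rightarrow> bool" where
  "is_tree G \<longleftrightarrow> simple_graph G \<and> connected_graph G \<and> \<not> (\<exists>c. is_cycle G c)"


section \<open>Generalized connectivity\<close>

definition S_tree :: "'a ugraph \<Rightarrow> 'a set \<Rightarrow> 'a ugraph \<Rightarrow> bool" where
  "S_tree G S T \<longleftrightarrow> is_tree T \<and> is_subgraph T G \<and> S \<subseteq> uverts T"

definition internally_edge_disjoint :: "'a set \<Rightarrow> nat \<Rightarrow> (nat \<Rightarrow> 'a ugraph) \<Rightarrow> bool" where
  "internally_edge_disjoint S r T \<longleftrightarrow>
     (\<forall>i < r. \<forall>j < r. i \<noteq> j \<longrightarrow>
        uverts (T i) \<inter> uverts (T j) = S \<and> uedges (T i) \<inter> uedges (T j) = {})"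

definition S_tree_packing_sizes :: "'a ugraph \<Rightarrow> 'a set \<Rightarrow> nat set" where
  "S_tree_packing_sizes G S =
     {r. \<exists>T. (\<forall>i < r. S_tree G S (T i)) \<and> internally_edge_disjoint S r T}"

definition kappa_set :: "'a ugraph \<Rightarrow> 'a set \<Rightarrow> nat" where
  "kappa_set G S = Max (S_tree_packing_sizes G S)"

definition gen_connectivity :: "nat \<Rightarrow> 'a ugraph \<Rightarrow> nat" where
  "gen_connectivity k G = Min {kappa_set G S | S. S \<subseteq> uverts G \<and> card S = k}"

text \<open>\<open>Max\<close> is a genuine maximum whenever \<open>G\<close> has finitely many edges and \<open>S\<close> has at least two
  elements: every \<open>S\<close>-tree then has an edge.\<close>

lemma S_tree_has_edge:
  assumes "S_tree G S T" and "x \<in> S" "y \<in> S" "x \<noteq> y"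
  shows "uedges T \<noteq> {}"
proof
  assume "uedges T = {}"
  then have "adj_rel T = {}"
    by (simp add: adj_rel_def)
  moreover have "(x, y) \<in> (adj_rel T)\<^sup>*"
    using assms by (auto simp: S_tree_def is_tree_def connected_graph_def)
  ultimately show False
    using \<open>x \<noteq> y\<close> by simp
qed

lemma finite_S_tree_packing_sizes:
  assumes fin: "finite (uedges G)" and S: "2 \<le> card S"
  shows "finite (S_tree_packing_sizes G S)"
proof -
  obtain x y where xy: "x \<in> S" "y \<in> S" "x \<noteq> y"
    using S by (auto simp: numeral_2_eq_2 card_le_Suc_iff)
  have "r \<le> card (uedges G)" if "r \<in> S_tree_packing_sizes G S" for r
  proof -
    obtain T where T: "\<And>i. i < r \<Longrightarrow> S_tree G S (T i)"
      and disj: "internally_edge_disjoint S r T"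
      using \<open>r \<in> S_tree_packing_sizes G S\<close> by (auto simp: S_tree_packing_sizes_def)
    have "\<forall>i \<in> {..<r}. \<exists>e. e \<in> uedges (T i)"
      using S_tree_has_edge[OF T xy] by fastforce
    then obtain f where f: "\<And>i. i < r \<Longrightarrow> f i \<in> uedges (T i)"
      by (metis lessThan_iff)
    have "inj_on f {..<r}"
    proof (rule inj_onI)
      fix i j
      assume "i \<in> {..<r}" "j \<in> {..<r}" "f i = f j"
      then show "i = j"
        using f disj unfolding internally_edge_disjoint_def
        by (metis disjoint_iff lessThan_iff)
    qed
    moreover have "f ` {..<r} \<subseteq> uedges G"
      using f T by (force simp: S_tree_def is_subgraph_def)
    ultimately show ?thesis
      using card_inj_on_le[OF _ _ fin] by fastforce
  qed
  then show ?thesis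
    by (meson atMost_iff finite_atMost finite_subset subsetI)
qed

lemma zero_in_S_tree_packing_sizes: "0 \<in> S_tree_packing_sizes G S"
  by (simp add: S_tree_packing_sizes_def internally_edge_disjoint_def)


section \<open>Godan graphs\<close>

definition cayley_graph :: "('a, 'b) monoid_scheme \<Rightarrow> 'a set \<Rightarrow> 'a ugraph" where
  "cayley_graph \<Gamma> \<Omega> =
     \<lparr>uverts = carrier \<Gamma>,
      uedges = {{u, v} | u v. u \<in> carrier \<Gamma> \<and> v \<in> carrier \<Gamma> \<and> (\<exists>s \<in> \<Omega>. u = v \<otimes>\<^bsub>\<Gamma>\<^esub> s)}\<rparr>"

text \<open>\<open>cycle_of_list [a, b, c]\<close> is the cycle sending \<open>a\<close> to \<open>b\<close>, \<open>b\<close> to \<open>c\<close> and \<open>c\<close> to \<open>a\<close>.\<close>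

definition godan_gens :: "nat \<Rightarrow> (nat \<Rightarrow> nat) set" where
  "godan_gens n =
     {transpose 1 2, cycle_of_list [1, 2, 3], cycle_of_list [1, 3, 2]} \<union>
     {transpose 1 2 \<circ> transpose 3 i | i. 4 \<le> i \<and> i \<le> n}"

definition godan_graph :: "nat \<Rightarrow> (nat \<Rightarrow> nat) ugraph" where
  "godan_graph n = cayley_graph (sym_group n) (godan_gens n)"

lemma godan_gens_inverse_closed:
  assumes "s \<in> godan_gens n"
  shows "\<exists>t \<in> godan_gens n. s \<circ> t = id"
proof -
  have 1: "transpose 1 2 \<circ> transpose 1 2 = (id :: nat \<Rightarrow> nat)"
    by simp
  have 2: "cycle_of_list [1, 2, 3] \<circ> cycle_of_list [1, 3, 2] = (id :: nat \<Rightarrow> nat)"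
    and 3: "cycle_of_list [1, 3, 2] \<circ> cycle_of_list [1, 2, 3] = (id :: nat \<Rightarrow> nat)"
    by (auto simp: fun_eq_iff transpose_def)
  have 4: "(transpose 1 2 \<circ> transpose 3 i) \<circ> (transpose 1 2 \<circ> transpose 3 i) = (id :: nat \<Rightarrow> nat)"
    if "4 \<le> i" for i
    using that by (auto simp: fun_eq_iff transpose_def)
  show ?thesis
    using assms 1 2 3 4 unfolding godan_gens_def by blast
qed

lemma godan_gens_neq_id: "id \<notin> godan_gens n"
proof -
  have "s 1 \<noteq> 1" if "s \<in> godan_gens n" for s
    using that by (auto simp: godan_gens_def transpose_def)
  then show ?thesis
    by force
qed

lemma godan_graph_adjacent_iff:
  assumes u: "u permutes {1..n}" and v: "v permutes {1..n}"
  shows "{u, v} \<in> uedges (godan_graph n) \<longleftrightarrow> (\<exists>s \<in> godan_gens n. u = v \<circ> s)"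
proof -
  have sym: "\<exists>s \<in> godan_gens n. y = x \<circ> s" if "s \<in> godan_gens n" "x = y \<circ> s" for x y s
    using godan_gens_inverse_closed[OF that(1)] that(2) by (metis comp_assoc comp_id)
  show ?thesis
    using u v sym
    by (auto simp: godan_graph_def cayley_graph_def sym_group_def doubleton_eq_iff)
qed

lemma simple_graph_godan: "simple_graph (godan_graph n)"
proof -
  have "v \<circ> s \<noteq> v" if "v permutes {1..n}" "s \<in> godan_gens n" for v s
  proof
    assume "v \<circ> s = v"
    then have "s = id"
      using permutes_inj[OF that(1)] by (simp add: fun_eq_iff inj_eq)
    then show False
      using that(2) godan_gens_neq_id by blast
  qed
  then show ?thesis
    unfolding simple_graph_def godan_graph_def cayley_graph_def sym_group_def
    by auto
qed

end

theory Submission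
  imports Defs
begin

text \<open>
  Upper bound: the graph has degree \<open>n\<close>, and the edge between two adjacent terminals lies in at most
  one tree, which needs a second edge at one of them.

  Lower bound: fixing the value at position \<open>n\<close> splits the graph into \<open>n\<close> copies of the graph of
  dimension \<open>n - 1\<close>, and right multiplication by \<open>(12)(3n)\<close> is a perfect matching between different
  copies, with at least two edges between any two of them. By induction each copy is
  \<open>(n - 1)\<close>-connected, so any vertex of it has a fan to any \<open>n - 1\<close> further vertices. The trees are
  assembled from such fans and matching edges, distinguishing whether the terminals lie in one, two or
  three copies. The induction starts at \<open>n = 3\<close> with a prism. Sets that are connected as induced
  subgraphs replace paths and trees; connectedness is defined by cuts.
\<close>

section \<open>Connected sets\<close>

text \<open>With \<open>k + 1\<close> parts that are \<open>k\<close>-connected, \<open>k\<close>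
  trees are wanted, so every count is tight: a fan in a part reaches only \<open>k\<close> vertices
  besides its root. A terminal that serves as its own exit costs nothing, and this saves the case of
  three parts. Connectivity must grow by one with the dimension. This is where two matching edges
  between any two parts are used: \<open>p\<close> parts against \<open>q\<close> parts give at
  least \<open>2 * p * q\<close> crossing edges without common ends, hence at least
  \<open>p + q\<close>; one edge per pair would fail for \<open>p = 1\<close>. Subgraphs that meet
  only in the terminal set can share only edges between terminals. So these edges are removed at
  first and then handed out to single trees by sets \<open>F i\<close>. The definition by cuts suits
  this, since deleting edges and gluing sets is checked one cut at a time. For a relation that is
  not symmetric, \<open>conn\<close> means strong connectivity.\<close>

definition conn :: "'a rel \<Rightarrow> 'a set \<Rightarrow> bool" where
  "conn R C \<longleftrightarrow>
     C \<noteq> {} \<and> (\<forall>D. D \<subseteq> C \<longrightarrow> D \<noteq> {} \<longrightarrow> D \<noteq> C \<longrightarrow> (\<exists>u\<in>D. \<exists>v\<in>C - D. (u, v) \<in> R))"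

text \<open>\<open>D\<close> may stick out of \<open>C\<close>, so one set can be tested against
  several connected sets at once.\<close>

lemma connD:
  assumes "conn R C" "D \<inter> C \<noteq> {}" "\<not> C \<subseteq> D"
  shows "\<exists>u\<in>D \<inter> C. \<exists>v\<in>C - D. (u, v) \<in> R"
proof -
  have "D \<inter> C \<subseteq> C" "D \<inter> C \<noteq> C"
    using assms by auto
  then show ?thesis
    using assms(1,2) unfolding conn_def by (metis Diff_Int2 Diff_Int_distrib2 Diff_iff IntI Int_iff)
qed

lemma connI:
  assumes "C \<noteq> {}"
    and "\<And>D. D \<subseteq> C \<Longrightarrow> D \<noteq> {} \<Longrightarrow> D \<noteq> C \<Longrightarrow> \<exists>u\<in>D. \<exists>v\<in>C - D. (u, v) \<in> R"
  shows "conn R C"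
  using assms unfolding conn_def by blast

lemma conn_nonempty: "conn R C \<Longrightarrow> C \<noteq> {}"
  by (simp add: conn_def)

lemma conn_singleton [simp]: "conn R {x}"
  by (auto simp: conn_def)

lemma conn_mono:
  assumes "conn R C" "R \<inter> C \<times> C \<subseteq> R'"
  shows "conn R' C"
proof (rule connI)
  show "C \<noteq> {}"
    using assms(1) by (rule conn_nonempty)
next
  fix D assume "D \<subseteq> C" "D \<noteq> {}" "D \<noteq> C"
  then have "\<exists>u\<in>D \<inter> C. \<exists>v\<in>C - D. (u, v) \<in> R"
    by (intro connD[OF assms(1)]) auto
  then show "\<exists>u\<in>D. \<exists>v\<in>C - D. (u, v) \<in> R'"
    using assms(2) by blast
qed

lemma conn_Un:
  assumes "conn R C" "conn R D" "C \<inter> D \<noteq> {}"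
  shows "conn R (C \<union> D)"
proof (rule connI)
  show "C \<union> D \<noteq> {}"
    using assms by auto
next
  fix X assume X: "X \<subseteq> C \<union> D" "X \<noteq> {}" "X \<noteq> C \<union> D"
  show "\<exists>u\<in>X. \<exists>v\<in>C \<union> D - X. (u, v) \<in> R"
  proof (cases "(X \<inter> C \<noteq> {} \<and> \<not> C \<subseteq> X) \<or> (X \<inter> D \<noteq> {} \<and> \<not> D \<subseteq> X)")
    case True
    then show ?thesis
      using connD[OF assms(1), of X] connD[OF assms(2), of X] by blast
  next
    case False
    then show ?thesis
      using X assms(3) by blast
  qed
qed

text \<open>A set that does not split \<open>B\<close> either misses \<open>B\<close>, and then a
  member of it has its own edge into \<open>B\<close>, or contains \<open>B\<close>, and then a
  missing member of \<open>S\<close> is reached from \<open>B\<close>.\<close>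

lemma conn_attach:
  assumes "conn R B" "sym R" "\<And>s. s \<in> S \<Longrightarrow> \<exists>b\<in>B. (s, b) \<in> R"
  shows "conn R (S \<union> B)"
proof (rule connI)
  show "S \<union> B \<noteq> {}"
    using conn_nonempty[OF assms(1)] by auto
next
  fix X assume X: "X \<subseteq> S \<union> B" "X \<noteq> {}" "X \<noteq> S \<union> B"
  show "\<exists>u\<in>X. \<exists>v\<in>S \<union> B - X. (u, v) \<in> R"
  proof (cases "X \<inter> B \<noteq> {} \<and> \<not> B \<subseteq> X")
    case True
    then show ?thesis
      using connD[OF assms(1), of X] by blast
  next
    case False
    then consider "X \<inter> B = {}" | "B \<subseteq> X" by blast
    then show ?thesis
    proof cases
      case 1
      then obtain s where "s \<in> X" "s \<in> S" using X by blast
      then show ?thesis using assms(3)[of s] 1 by blast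
    next
      case 2
      then obtain s where s: "s \<in> S" "s \<notin> X" using X by blast
      then obtain b where "b \<in> B" "(b, s) \<in> R"
        using assms(3)[of s] symD[OF assms(2)] by blast
      then show ?thesis using s 2 by blast
    qed
  qed
qed

lemma conn_edge_Un:
  assumes "conn R C" "conn R D" "sym R" "u \<in> C" "v \<in> D" "(u, v) \<in> R"
  shows "conn R (C \<union> D)"
proof -
  have "conn R ({u} \<union> D)"
    by (rule conn_attach[OF assms(2,3)]) (use assms in auto)
  then have "conn R (C \<union> ({u} \<union> D))"
    using assms(4) by (intro conn_Un[OF assms(1)]) auto
  moreover have "C \<union> ({u} \<union> D) = C \<union> D"
    using assms(4) by blast
  ultimately show ?thesis by simp
qed

text \<open>An edge across a cut has two different ends, and \<open>C\<close> contains at most one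
  terminal, so no such edge inside \<open>C\<close> lies in \<open>S \<times> S\<close>.\<close>

lemma conn_off_terminals:
  assumes "conn E C" "C \<inter> S \<subseteq> {r}"
  shows "conn (E - S \<times> S) C"
proof (rule connI)
  show "C \<noteq> {}"
    using assms(1) by (rule conn_nonempty)
next
  fix D assume D: "D \<subseteq> C" "D \<noteq> {}" "D \<noteq> C"
  then have "\<exists>u\<in>D \<inter> C. \<exists>v\<in>C - D. (u, v) \<in> E"
    by (intro connD[OF assms(1)]) auto
  then show "\<exists>u\<in>D. \<exists>v\<in>C - D. (u, v) \<in> E - S \<times> S"
    using assms(2) by blast
qed


section \<open>Menger's theorem\<close>

text \<open>The separations of graph theory, of order \<open>card (P \<inter> Q)\<close>. Testing
  edges in one direction is enough for symmetric \<open>E\<close>.\<close>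

definition separation :: "'a rel \<Rightarrow> 'a set \<Rightarrow> 'a set \<Rightarrow> 'a set \<Rightarrow> bool" where
  "separation E V P Q \<longleftrightarrow> P \<union> Q = V \<and> (\<forall>u\<in>P - Q. \<forall>v\<in>Q - P. (u, v) \<notin> E)"

text \<open>The conclusion of Menger's theorem, with disjoint paths thickened to disjoint connected
  sets. Single vertices of \<open>A \<inter> B\<close> are allowed as members.\<close>

definition linked :: "'a rel \<Rightarrow> 'a set \<Rightarrow> 'a set \<Rightarrow> 'a set \<Rightarrow> nat \<Rightarrow> bool" where
  "linked E V A B k \<longleftrightarrow>
     (\<exists>\<C>. card \<C> = k \<and> finite \<C> \<and> disjoint \<C> \<and>
        (\<forall>C\<in>\<C>. C \<subseteq> V \<and> conn E C \<and> C \<inter> A \<noteq> {} \<and> C \<inter> B \<noteq> {}))"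

lemma linked_commute: "linked E V A B k \<longleftrightarrow> linked E V B A k"
  unfolding linked_def by blast

lemma linkedI:
  assumes "finite I" "card I = k"
    and "\<And>i. i \<in> I \<Longrightarrow> D i \<subseteq> V \<and> conn E (D i) \<and> D i \<inter> A \<noteq> {} \<and> D i \<inter> B \<noteq> {}"
    and "\<And>i j. i \<in> I \<Longrightarrow> j \<in> I \<Longrightarrow> i \<noteq> j \<Longrightarrow> D i \<inter> D j = {}"
  shows "linked E V A B k"
proof -
  have "inj_on D I"
    using assms(3,4) by (intro inj_onI) (metis conn_nonempty inf.idem)
  then have "card (D ` I) = k"
    using assms(2) by (simp add: card_image)
  moreover have "disjoint (D ` I)"
    unfolding disjoint_def using assms(4) by blast
  ultimately show ?thesis
    unfolding linked_def using assms(1,3) by (intro exI[of _ "D ` I"]) blast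
qed

text \<open>Each of the \<open>k\<close> disjoint sets contains a point of \<open>X\<close>. The
  chosen points are distinct and \<open>X\<close> has only \<open>k\<close> elements, so the sets
  can be named by the points of \<open>X\<close>.\<close>

lemma linked_index:
  assumes "linked E V A X k" "finite X" "card X = k"
  obtains D where
    "\<And>t. t \<in> X \<Longrightarrow> D t \<subseteq> V \<and> conn E (D t) \<and> D t \<inter> A \<noteq> {} \<and> t \<in> D t"
    "\<And>t t'. t \<in> X \<Longrightarrow> t' \<in> X \<Longrightarrow> t \<noteq> t' \<Longrightarrow> D t \<inter> D t' = {}"
proof -
  obtain \<C> where \<C>: "card \<C> = k" "finite \<C>" "disjoint \<C>"
    "\<And>C. C \<in> \<C> \<Longrightarrow> C \<subseteq> V \<and> conn E C \<and> C \<inter> A \<noteq> {} \<and> C \<inter> X \<noteq> {}"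
    using assms(1) unfolding linked_def by blast
  have "\<forall>C\<in>\<C>. \<exists>t. t \<in> C \<inter> X"
    using \<C>(4) by blast
  then obtain h where h: "\<And>C. C \<in> \<C> \<Longrightarrow> h C \<in> C \<inter> X"
    by metis
  have inj: "inj_on h \<C>"
    using h \<C>(3) unfolding disjoint_def by (intro inj_onI) (metis Int_iff disjoint_iff)
  have "h ` \<C> = X"
    by (rule card_subset_eq[OF assms(2)]) (use h \<C>(1) assms(3) inj in \<open>auto simp: card_image\<close>)
  then have bij: "bij_betw h \<C> X"
    using inj by (simp add: bij_betw_def)
  define D where "D = the_inv_into \<C> h"
  have D: "D t \<in> \<C>" "h (D t) = t" if "t \<in> X" for t
    using that bij unfolding D_def
    by (auto simp: bij_betw_def intro: the_inv_into_into f_the_inv_into_f)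
  show ?thesis
  proof
    fix t assume "t \<in> X"
    then show "D t \<subseteq> V \<and> conn E (D t) \<and> D t \<inter> A \<noteq> {} \<and> t \<in> D t"
      using \<C>(4)[of "D t"] h[of "D t"] D[of t] by auto
  next
    fix t t' assume "t \<in> X" "t' \<in> X" "t \<noteq> t'"
    then show "D t \<inter> D t' = {}"
      using \<C>(3) D[of t] D[of t'] unfolding disjoint_def by metis
  qed
qed

text \<open>Goering's deletion argument: if deleting an edge \<open>xy\<close> creates a separation with fewer than
  \<open>k\<close> common vertices, then adding \<open>x\<close>, respectively \<open>y\<close>, to its common part gives two sets of
  size \<open>k\<close>, and the linkages obtained on both sides are glued along them.\<close>

lemma menger_glue:
  assumes E: "sym E" and V: "finite V"
    and sep: "\<And>P Q. separation E V P Q \<Longrightarrow> A \<subseteq> P \<Longrightarrow> B \<subseteq> Q \<Longrightarrow> k \<le> card (P \<inter> Q)"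
    and IH: "\<And>V' A' B'. V' \<subset> V \<Longrightarrow> {x, y} - V' \<noteq> {} \<Longrightarrow> A' \<subseteq> V' \<Longrightarrow> B' \<subseteq> V' \<Longrightarrow>
      (\<And>P Q. separation E V' P Q \<Longrightarrow> A' \<subseteq> P \<Longrightarrow> B' \<subseteq> Q \<Longrightarrow> k \<le> card (P \<inter> Q)) \<Longrightarrow>
      linked E V' A' B' k"
    and xy: "(x, y) \<in> E"
    and PQ: "separation (E - {(x, y), (y, x)}) V P Q" "A \<subseteq> P" "B \<subseteq> Q" "card (P \<inter> Q) < k"
    and x: "x \<in> P - Q" and y: "y \<in> Q - P"
  shows "linked E V A B k"
proof -
  define X where "X = P \<inter> Q"
  have fin: "finite P" "finite Q" "finite X" and PQV: "P \<union> Q = V"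
    using PQ(1) V unfolding separation_def X_def by auto
  have noedge: "u = x \<and> v = y" if "u \<in> P - Q" "v \<in> Q - P" "(u, v) \<in> E" for u v
    using that PQ(1) x y unfolding separation_def by blast
  \<comment> \<open>The edge \<open>xy\<close> is the only one from \<open>P - Q\<close> to
    \<open>Q - P\<close>, so moving \<open>y\<close> into the first side repairs the separation. Its
    order grows by one, hence the common part had exactly \<open>k - 1\<close> elements.\<close>
  have "separation E V (insert y P) Q"
    unfolding separation_def using noedge PQV y by blast
  then have "k \<le> card (insert y P \<inter> Q)"
    using PQ by (intro sep) auto
  moreover have "insert y P \<inter> Q = insert y X" "insert y P \<inter> Q \<noteq> X"
    using y by (auto simp: X_def)
  moreover have "card (insert y X) = Suc (card X)"
    using y fin by (simp add: X_def)
  ultimately have cX: "Suc (card X) = k"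
    using PQ(4) by (simp add: X_def)
  have cards: "card (insert x X) = k" "card (insert y X) = k"
    using cX fin x y by (auto simp: X_def)
  have "linked E P A (insert x X) k"
  proof (rule IH)
    show "P \<subset> V" "{x, y} - P \<noteq> {}" "A \<subseteq> P" "insert x X \<subseteq> P"
      using PQV x y PQ(2) by (auto simp: X_def)
    fix M N assume MN: "separation E P M N" "A \<subseteq> M" "insert x X \<subseteq> N"
    \<comment> \<open>Adding \<open>Q\<close> to the second side is harmless: a vertex of
      \<open>P - Q\<close> with an edge to \<open>Q - P\<close> can only be \<open>x\<close>, which
      lies in \<open>N\<close>. The order is unchanged because \<open>X\<close> lies in
      \<open>N\<close>.\<close>
    have "separation E V M (N \<union> Q)"
      unfolding separation_def
    proof (intro conjI ballI notI)
      show "M \<union> (N \<union> Q) = V"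
        using MN(1) PQV unfolding separation_def by blast
    next
      fix u v assume uv: "u \<in> M - (N \<union> Q)" "v \<in> N \<union> Q - M" "(u, v) \<in> E"
      have "u \<in> P"
        using uv MN(1) unfolding separation_def by blast
      then show False
        using uv MN noedge[of u v] unfolding separation_def X_def by blast
    qed
    then have "k \<le> card (M \<inter> (N \<union> Q))"
      using MN PQ(3) by (intro sep) auto
    moreover have "M \<inter> (N \<union> Q) = M \<inter> N"
      using MN unfolding separation_def X_def by blast
    ultimately show "k \<le> card (M \<inter> N)" by simp
  qed
  then obtain D1 where D1:
    "\<And>t. t \<in> insert x X \<Longrightarrow> D1 t \<subseteq> P \<and> conn E (D1 t) \<and> D1 t \<inter> A \<noteq> {} \<and> t \<in> D1 t"
    "\<And>t t'. t \<in> insert x X \<Longrightarrow> t' \<in> insert x X \<Longrightarrow> t \<noteq> t' \<Longrightarrow> D1 t \<inter> D1 t' = {}"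
    by (rule linked_index) (use fin cards in auto)
  have "linked E Q (insert y X) B k"
  proof (rule IH)
    show "Q \<subset> V" "{x, y} - Q \<noteq> {}" "B \<subseteq> Q" "insert y X \<subseteq> Q"
      using PQV x y PQ(3) by (auto simp: X_def)
    fix M N assume MN: "separation E Q M N" "insert y X \<subseteq> M" "B \<subseteq> N"
    have "separation E V (M \<union> P) N"
      unfolding separation_def
    proof (intro conjI ballI notI)
      show "M \<union> P \<union> N = V"
        using MN(1) PQV unfolding separation_def by blast
    next
      fix u v assume uv: "u \<in> M \<union> P - N" "v \<in> N - (M \<union> P)" "(u, v) \<in> E"
      have "v \<in> Q"
        using uv MN(1) unfolding separation_def by blast
      then show False
        using uv MN noedge[of u v] unfolding separation_def X_def by blast
    qed
    then have "k \<le> card ((M \<union> P) \<inter> N)"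
      using MN PQ(2) by (intro sep) auto
    moreover have "(M \<union> P) \<inter> N = M \<inter> N"
      using MN unfolding separation_def X_def by blast
    ultimately show "k \<le> card (M \<inter> N)" by simp
  qed
  then have "linked E Q B (insert y X) k"
    by (simp only: linked_commute[of E Q B])
  then obtain D2 where D2:
    "\<And>t. t \<in> insert y X \<Longrightarrow> D2 t \<subseteq> Q \<and> conn E (D2 t) \<and> D2 t \<inter> B \<noteq> {} \<and> t \<in> D2 t"
    "\<And>t t'. t \<in> insert y X \<Longrightarrow> t' \<in> insert y X \<Longrightarrow> t \<noteq> t' \<Longrightarrow> D2 t \<inter> D2 t' = {}"
    by (rule linked_index) (use fin cards in auto)
  \<comment> \<open>The set ending in \<open>x\<close> continues along the edge \<open>xy\<close>; a
    set ending in the common part continues at the same vertex.\<close>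
  define g where "g t = (if t = x then y else t)" for t
  have g: "g t \<in> insert y X" if "t \<in> insert x X" for t
    using that by (auto simp: g_def)
  have g_inj: "g t \<noteq> g t'" if "t \<in> insert x X" "t' \<in> insert x X" "t \<noteq> t'" for t t'
    using that y by (auto simp: g_def X_def split: if_splits)
  \<comment> \<open>A common point lies in \<open>X\<close>, and a set of either family contains no
    point of \<open>X\<close> except possibly its own index.\<close>
  have "D1 t \<inter> D2 (g t') = {}" if "t \<in> insert x X" "t' \<in> insert x X" "t \<noteq> t'" for t t'
  proof (rule ccontr)
    assume "D1 t \<inter> D2 (g t') \<noteq> {}"
    then obtain w where w: "w \<in> D1 t" "w \<in> D2 (g t')" by blast
    then have wX: "w \<in> X"
      using D1(1)[OF that(1)] D2(1)[OF g[OF that(2)]] by (auto simp: X_def)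
    then have "w = t"
      using D1(1)[of w] D1(2)[of w t] that w by blast
    moreover have "w = g t'"
      using D2(1)[of w] D2(2)[of w "g t'"] g[OF that(2)] wX w by blast
    ultimately show False
      using that wX x y by (auto simp: g_def X_def split: if_splits)
  qed
  note cross = this
  show ?thesis
  proof (rule linkedI[of "insert x X" _ "\<lambda>t. D1 t \<union> D2 (g t)"])
    fix t assume t: "t \<in> insert x X"
    have "conn E (D1 t \<union> D2 (g t))"
    proof (cases "t = x")
      case True
      then show ?thesis
        using D1(1)[OF t] D2(1)[OF g[OF t]] xy E
        by (intro conn_edge_Un[of _ _ _ x y]) (auto simp: g_def)
    next
      case False
      then show ?thesis
        using D1(1)[OF t] D2(1)[OF g[OF t]] by (intro conn_Un) (auto simp: g_def)
    qed
    then show "D1 t \<union> D2 (g t) \<subseteq> V \<and> conn E (D1 t \<union> D2 (g t)) \<and>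
        (D1 t \<union> D2 (g t)) \<inter> A \<noteq> {} \<and> (D1 t \<union> D2 (g t)) \<inter> B \<noteq> {}"
      using D1(1)[OF t] D2(1)[OF g[OF t]] PQV by blast
  next
    fix t t' assume t: "t \<in> insert x X" "t' \<in> insert x X" "t \<noteq> t'"
    show "(D1 t \<union> D2 (g t)) \<inter> (D1 t' \<union> D2 (g t')) = {}"
      using D1(2)[OF t] D2(2)[OF g[OF t(1)] g[OF t(2)] g_inj[OF t]] cross[OF t]
        cross[OF t(2,1)] t(3) by blast
  qed (use fin cards in auto)
qed

text \<open>Induction on the number of edges inside \<open>V\<close>. Either the bound on
  separations survives the deletion of an edge, or a small separation appears and the deletion
  argument applies on both of its sides.\<close>

theorem menger:
  fixes E :: "'a rel"
  assumes "sym E" "finite V" "A \<subseteq> V" "B \<subseteq> V"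
    and "\<And>P Q. separation E V P Q \<Longrightarrow> A \<subseteq> P \<Longrightarrow> B \<subseteq> Q \<Longrightarrow> k \<le> card (P \<inter> Q)"
  shows "linked E V A B k"
  using assms
proof (induction "card (E \<inter> V \<times> V)" arbitrary: E V A B rule: less_induct)
  case less
  note E = less.prems(1) and V = less.prems(2) and sep = less.prems(5)
  show ?case
  proof (cases "\<exists>x\<in>V. \<exists>y\<in>V. x \<noteq> y \<and> (x, y) \<in> E")
    case False
    \<comment> \<open>Without edges between distinct vertices every covering pair is a separation.
      The common part of this one is \<open>A \<inter> B\<close>, whose points serve as the required
      sets.\<close>
    then have "separation E V A ((V - A) \<union> B)"
      unfolding separation_def using less.prems(3,4)
      by (intro conjI ballI) (blast, metis Diff_iff Un_iff subsetD)
    then have "k \<le> card (A \<inter> ((V - A) \<union> B))"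
      by (rule sep) auto
    also have "A \<inter> ((V - A) \<union> B) = A \<inter> B" by blast
    finally obtain I where I: "I \<subseteq> A \<inter> B" "card I = k" "finite I"
      by (metis obtain_subset_with_card_n)
    then show ?thesis
      using less.prems(3) by (intro linkedI[of I _ "\<lambda>x. {x}"]) auto
  next
    case True
    then obtain x y where xy: "x \<in> V" "y \<in> V" "x \<noteq> y" "(x, y) \<in> E" by blast
    define E' where "E' = E - {(x, y), (y, x)}"
    have E': "sym E'"
      using E unfolding E'_def sym_def by blast
    have fin: "finite (E \<inter> V \<times> V)"
      using V by auto
    \<comment> \<open>\<open>V'\<close> misses an end of \<open>xy\<close>, so the number of edges
      drops strictly.\<close>
    have IH: "linked E V' A' B' k"
      if "V' \<subset> V" "{x, y} - V' \<noteq> {}" "A' \<subseteq> V'" "B' \<subseteq> V'"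
        "\<And>P Q. separation E V' P Q \<Longrightarrow> A' \<subseteq> P \<Longrightarrow> B' \<subseteq> Q \<Longrightarrow> k \<le> card (P \<inter> Q)"
      for V' A' B'
    proof (rule less.hyps)
      have "E \<inter> V' \<times> V' \<subset> E \<inter> V \<times> V"
        using xy that(1,2) by blast
      then show "card (E \<inter> V' \<times> V') < card (E \<inter> V \<times> V)"
        using fin by (rule psubset_card_mono[rotated])
      show "finite V'"
        using that(1) V by (auto intro: finite_subset)
    qed (use that E in auto)
    show ?thesis
    proof (cases "\<forall>P Q. separation E' V P Q \<longrightarrow> A \<subseteq> P \<longrightarrow> B \<subseteq> Q \<longrightarrow> k \<le> card (P \<inter> Q)")
      case True
      have "E' \<inter> V \<times> V \<subset> E \<inter> V \<times> V"
        using xy unfolding E'_def by blast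
      then have "card (E' \<inter> V \<times> V) < card (E \<inter> V \<times> V)"
        using fin by (rule psubset_card_mono[rotated])
      then have "linked E' V A B k"
        by (rule less.hyps) (use True less.prems E' in auto)
      moreover have "conn E C" if "conn E' C" for C
        by (rule conn_mono[OF that]) (auto simp: E'_def)
      ultimately show ?thesis
        unfolding linked_def by blast
    next
      case False
      then obtain P Q where PQ: "separation E' V P Q" "A \<subseteq> P" "B \<subseteq> Q" "card (P \<inter> Q) < k"
        by force
      then have "\<not> separation E V P Q"
        using sep[of P Q] by linarith
      then obtain u v where "u \<in> P - Q" "v \<in> Q - P" "(u, v) \<in> E" "(u, v) \<notin> E'"
        using PQ(1) unfolding separation_def by blast
      then consider "x \<in> P - Q" "y \<in> Q - P" | "y \<in> P - Q" "x \<in> Q - P"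
        unfolding E'_def by blast
      then show ?thesis
      proof cases
        case 1
        then show ?thesis
          by (intro menger_glue[of E V A B k x y P Q]) (use less.prems IH xy PQ E'_def in auto)
      next
        case 2
        have "(y, x) \<in> E" "E' = E - {(y, x), (x, y)}"
          using xy(4) E unfolding E'_def sym_def by auto
        with 2 show ?thesis
          by (intro menger_glue[of E V A B k y x P Q])
            (use less.prems IH PQ in \<open>auto simp: insert_commute\<close>)
      qed
    qed
  qed
qed


section \<open>Higher connectivity and fans\<close>

definition k_connected :: "'a rel \<Rightarrow> 'a set \<Rightarrow> nat \<Rightarrow> bool" where
  "k_connected E V k \<longleftrightarrow>
     (\<forall>P Q. separation E V P Q \<longrightarrow> P - Q \<noteq> {} \<longrightarrow> Q - P \<noteq> {} \<longrightarrow> k \<le> card (P \<inter> Q))"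

lemma k_connectedD:
  "k_connected E V k \<Longrightarrow> separation E V P Q \<Longrightarrow> P - Q \<noteq> {} \<Longrightarrow> Q - P \<noteq> {} \<Longrightarrow> k \<le> card (P \<inter> Q)"
  unfolding k_connected_def by blast

lemma k_connected_imp_conn:
  assumes "k_connected E V k" "0 < k" "V \<noteq> {}"
  shows "conn E V"
proof (rule connI)
  fix D assume D: "D \<subseteq> V" "D \<noteq> {}" "D \<noteq> V"
  show "\<exists>u\<in>D. \<exists>v\<in>V - D. (u, v) \<in> E"
  proof (rule ccontr)
    assume "\<not> ?thesis"
    then have "separation E V D (V - D)"
      using D unfolding separation_def by blast
    then have "k \<le> card (D \<inter> (V - D))"
      by (rule k_connectedD[OF assms(1)]) (use D in auto)
    then show False
      using assms(2) by simp
  qed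
qed (rule assms(3))

text \<open>The neighbours of \<open>y\<close> separate it from the rest unless every vertex is a
  neighbour. Since \<open>k_connected\<close> sets no lower bound on the number of vertices and
  complete sets satisfy it for every \<open>k\<close>, the size of \<open>V\<close> has to be
  assumed.\<close>

lemma k_connected_degree:
  assumes "k_connected E V k" "finite V" "k < card V" "y \<in> V"
  shows "k \<le> card {v \<in> V - {y}. (y, v) \<in> E}"
proof -
  let ?N = "{v \<in> V - {y}. (y, v) \<in> E}"
  have sep: "separation E V (insert y ?N) (V - {y})"
    using assms(4) unfolding separation_def by blast
  have eq: "insert y ?N \<inter> (V - {y}) = ?N" by blast
  show ?thesis
  proof (cases "V - {y} - insert y ?N = {}")
    case True
    then have "?N = V - {y}" by blast
    then show ?thesis
      using assms(2-4) by simp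
  next
    case False
    then show ?thesis
      using k_connectedD[OF assms(1) sep] eq by auto
  qed
qed

text \<open>Menger's theorem in \<open>V - {r}\<close>, between the neighbours of \<open>r\<close>
  and the targets: a separation there extends to \<open>V\<close> by putting \<open>r\<close> on the
  side of its neighbours. The root may itself be a target, with the set \<open>{r}\<close>, and then
  does not count against \<open>k\<close>.\<close>

lemma fan:
  assumes E: "sym E" and V: "finite V" and k: "k_connected E V k"
    and r: "r \<in> V" and Y: "Y \<subseteq> V" "card (Y - {r}) \<le> k"
  obtains \<phi> where
    "\<And>t. t \<in> Y \<Longrightarrow> \<phi> t \<subseteq> V" "\<And>t. t \<in> Y \<Longrightarrow> r \<in> \<phi> t" "\<And>t. t \<in> Y \<Longrightarrow> t \<in> \<phi> t"
    "\<And>t. t \<in> Y \<Longrightarrow> conn E (\<phi> t)"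
    "\<And>t t'. t \<in> Y \<Longrightarrow> t' \<in> Y \<Longrightarrow> t \<noteq> t' \<Longrightarrow> \<phi> t \<inter> \<phi> t' = {r}"
proof -
  let ?N = "{v \<in> V - {r}. (r, v) \<in> E}"
  have finY: "finite Y"
    using Y V by (auto intro: finite_subset)
  have "linked E (V - {r}) ?N (Y - {r}) (card (Y - {r}))"
  proof (rule menger[OF E])
    fix P Q assume PQ: "separation E (V - {r}) P Q" "?N \<subseteq> P" "Y - {r} \<subseteq> Q"
    have fin: "finite (P \<inter> Q)"
      using PQ(1) V unfolding separation_def by (metis finite_Diff finite_Int finite_Un)
    show "card (Y - {r}) \<le> card (P \<inter> Q)"
    proof (cases "Q - P = {}")
      case True
      then show ?thesis
        using PQ(3) fin by (intro card_mono) auto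
    next
      case False
      have rQ: "r \<notin> Q" "P \<union> Q = V - {r}"
        using PQ(1) unfolding separation_def by auto
      have "separation E V (insert r P) Q"
        using PQ(1,2) rQ r unfolding separation_def by auto
      then have "k \<le> card (insert r P \<inter> Q)"
        by (rule k_connectedD[OF k]) (use False rQ in auto)
      also have "insert r P \<inter> Q = P \<inter> Q"
        using rQ by auto
      finally show ?thesis
        using Y(2) by linarith
    qed
  qed (use V Y in auto)
  then obtain D where D:
    "\<And>t. t \<in> Y - {r} \<Longrightarrow> D t \<subseteq> V - {r} \<and> conn E (D t) \<and> D t \<inter> ?N \<noteq> {} \<and> t \<in> D t"
    "\<And>t t'. t \<in> Y - {r} \<Longrightarrow> t' \<in> Y - {r} \<Longrightarrow> t \<noteq> t' \<Longrightarrow> D t \<inter> D t' = {}"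
    by (rule linked_index) (use finY in auto)
  define \<phi> where "\<phi> t = (if t = r then {r} else {r} \<union> D t)" for t
  show ?thesis
  proof
    fix t assume t: "t \<in> Y"
    show "\<phi> t \<subseteq> V" "r \<in> \<phi> t" "t \<in> \<phi> t"
      using D(1)[of t] t r by (auto simp: \<phi>_def)
    show "conn E (\<phi> t)"
    proof (cases "t = r")
      case False
      then have "conn E ({r} \<union> D t)"
        using D(1)[of t] t E by (intro conn_attach) auto
      then show ?thesis
        using False by (simp add: \<phi>_def)
    qed (simp add: \<phi>_def)
  next
    fix t t' assume "t \<in> Y" "t' \<in> Y" "t \<noteq> t'"
    then show "\<phi> t \<inter> \<phi> t' = {r}"
      using D(2)[of t t'] D(1)[of t] D(1)[of t'] by (auto simp: \<phi>_def)
  qed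
qed

section \<open>Packings of connected subgraphs\<close>

text \<open>The subgraphs only have to be connected; spanning trees are extracted in
  \<open>packing_imp_S_trees\<close>. Edges are recorded separately because all the subgraphs
  contain the same terminals, which may be adjacent.\<close>

definition packing :: "'a rel \<Rightarrow> 'a set \<Rightarrow> 'a set \<Rightarrow> nat \<Rightarrow> bool" where
  "packing E V S r \<longleftrightarrow>
     (\<exists>W R. (\<forall>i<r. S \<subseteq> W i \<and> W i \<subseteq> V \<and> R i \<subseteq> E \<inter> W i \<times> W i \<and> sym (R i) \<and> conn (R i) (W i)) \<and>
        (\<forall>i<r. \<forall>j<r. i \<noteq> j \<longrightarrow> W i \<inter> W j = S \<and> R i \<inter> R j = {}))"

text \<open>Vertex sets that meet exactly in \<open>S\<close> can share edges only inside
  \<open>S\<close>, so it is enough to distribute those by \<open>F\<close>. The index type is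
  arbitrary because trees are named by fan targets or by parts.\<close>

lemma packingI:
  fixes W :: "'i \<Rightarrow> 'a set"
  assumes E: "sym E" and I: "finite I" "card I = r"
    and W: "\<And>i. i \<in> I \<Longrightarrow> S \<subseteq> W i \<and> W i \<subseteq> V \<and> conn ((E - S \<times> S) \<union> F i) (W i)"
    and F: "\<And>i. i \<in> I \<Longrightarrow> F i \<subseteq> E \<inter> S \<times> S \<and> sym (F i)"
    and disj: "\<And>i j. i \<in> I \<Longrightarrow> j \<in> I \<Longrightarrow> i \<noteq> j \<Longrightarrow> W i \<inter> W j = S \<and> F i \<inter> F j = {}"
  shows "packing E V S r"
proof -
  obtain h where h: "bij_betw h {0..<r} I"
    using ex_bij_betw_nat_finite[OF I(1)] I(2) by auto
  define R where "R i = ((E - S \<times> S) \<union> F i) \<inter> W i \<times> W i" for i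
  have hI: "h i \<in> I" if "i < r" for i
    using h that by (auto simp: bij_betw_def)
  have hne: "h i \<noteq> h j" if "i < r" "j < r" "i \<noteq> j" for i j
    using h that by (auto simp: bij_betw_def inj_on_def)
  have R: "R i \<subseteq> E \<inter> W i \<times> W i \<and> sym (R i) \<and> conn (R i) (W i)" if "i \<in> I" for i
  proof (intro conjI)
    show "R i \<subseteq> E \<inter> W i \<times> W i"
      using F[OF that] by (auto simp: R_def)
    show "sym (R i)"
      using F[OF that] E unfolding R_def sym_def by blast
    show "conn (R i) (W i)"
      by (rule conn_mono[of "(E - S \<times> S) \<union> F i"]) (use W[OF that] in \<open>auto simp: R_def\<close>)
  qed
  have "R i \<inter> R j = {}" if "i \<in> I" "j \<in> I" "i \<noteq> j" for i j
  proof -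
    have "R i \<inter> R j \<subseteq> (W i \<inter> W j) \<times> (W i \<inter> W j)"
      by (auto simp: R_def)
    then have "R i \<inter> R j \<subseteq> S \<times> S"
      using disj[OF that] by simp
    then show ?thesis
      using disj[OF that] unfolding R_def by blast
  qed
  then show ?thesis
    unfolding packing_def
    by (intro exI[of _ "W \<circ> h"] exI[of _ "R \<circ> h"]) (use hI hne R W disj in auto)
qed

lemma packing_one:
  assumes "sym E" "conn E V" "S \<subseteq> V"
  shows "packing E V S 1"
proof (rule packingI[of _ "{()}" _ _ "\<lambda>_. V" _ "\<lambda>_. E \<inter> S \<times> S"])
  show "S \<subseteq> V \<and> V \<subseteq> V \<and> conn (E - S \<times> S \<union> E \<inter> S \<times> S) V"
  proof -
    have "E - S \<times> S \<union> E \<inter> S \<times> S = E"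
      by blast
    then show ?thesis
      using assms by simp
  qed
  show "E \<inter> S \<times> S \<subseteq> E \<inter> S \<times> S \<and> sym (E \<inter> S \<times> S)"
    using assms(1) unfolding sym_def by blast
qed (use assms in auto)

text \<open>The additional tree consists of everything outside \<open>A\<close>, joined to the
  terminals. It uses no edge inside \<open>A\<close>, not even one between terminals, so all of
  these stay with the given packing.\<close>

lemma packing_same_part:
  assumes E: "sym E" and A: "A \<subseteq> V" and S: "S \<subseteq> A" and pack: "packing E A S r"
    and rest: "conn E (V - A)"
    and out: "\<And>s. s \<in> S \<Longrightarrow> \<exists>b\<in>V - A. (s, b) \<in> E"
  shows "packing E V S (Suc r)"
proof -
  obtain W R
    where WR: "\<forall>i<r. S \<subseteq> W i \<and> W i \<subseteq> A \<and> R i \<subseteq> E \<inter> W i \<times> W i \<and> sym (R i) \<and> conn (R i) (W i)"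
      "\<forall>i<r. \<forall>j<r. i \<noteq> j \<longrightarrow> W i \<inter> W j = S \<and> R i \<inter> R j = {}"
    using pack unfolding packing_def by (elim exE conjE) (rule that)
  note W = WR(1)[rule_format] and disj = WR(2)[rule_format]
  define U where "U = S \<union> (V - A)"
  define Q where "Q = E \<inter> U \<times> U - A \<times> A"
  have Q: "Q \<subseteq> E \<inter> U \<times> U" "sym Q" "Q \<inter> A \<times> A = {}"
    using E unfolding Q_def sym_def by auto
  have "conn Q (V - A)"
    by (rule conn_mono[OF rest]) (auto simp: Q_def U_def)
  then have conn: "conn Q U"
    unfolding U_def
  proof (rule conn_attach[OF _ Q(2)])
    fix s assume "s \<in> S"
    then show "\<exists>b\<in>V - A. (s, b) \<in> Q"
      using out[of s] by (auto simp: Q_def U_def)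
  qed
  have U: "S \<subseteq> U" "U \<subseteq> V" "U \<inter> A = S"
    using A S by (auto simp: U_def)
  have WU: "W i \<inter> U = S" "R i \<inter> Q = {}" if "i < r" for i
  proof -
    have Wi: "S \<subseteq> W i" "W i \<subseteq> A" "R i \<subseteq> W i \<times> W i"
      using W[OF that] by auto
    show "W i \<inter> U = S"
      using Wi(1,2) U(1,3) by blast
    show "R i \<inter> Q = {}"
      using Wi(2,3) Q(3) by blast
  qed
  show ?thesis
    unfolding packing_def
  proof (intro exI[of _ "W(r := U)"] exI[of _ "R(r := Q)"] conjI allI impI)
    fix i assume i: "i < Suc r"
    have "S \<subseteq> (W(r := U)) i \<and> (W(r := U)) i \<subseteq> V \<and> sym ((R(r := Q)) i) \<and>
      (R(r := Q)) i \<subseteq> E \<inter> (W(r := U)) i \<times> (W(r := U)) i \<and> conn ((R(r := Q)) i) ((W(r := U)) i)"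
    proof (cases "i = r")
      case True
      then show ?thesis
        using U Q conn by simp
    next
      case False
      then show ?thesis
        using i W[of i] A by auto
    qed
    then show "S \<subseteq> (W(r := U)) i" "(W(r := U)) i \<subseteq> V" "sym ((R(r := Q)) i)"
      "(R(r := Q)) i \<subseteq> E \<inter> (W(r := U)) i \<times> (W(r := U)) i" "conn ((R(r := Q)) i) ((W(r := U)) i)"
      by blast+
    fix j assume j: "j < Suc r" "i \<noteq> j"
    show "(W(r := U)) i \<inter> (W(r := U)) j = S" "(R(r := Q)) i \<inter> (R(r := Q)) j = {}"
      using i j WU[of i] WU[of j] disj[of i j]
      by (cases "i = r"; cases "j = r"; simp add: Int_commute)+
  qed
qed

text \<open>A fan from \<open>x\<close> to \<open>y\<close> and \<open>k - 1\<close> neighbours of \<open>y\<close> yields \<open>k\<close> disjoint \<open>x\<close>-\<open>y\<close> connections;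
  the one reaching \<open>y\<close> directly leaves \<open>A\<close> at \<open>x\<close>, the others leave it at the neighbour of \<open>y\<close>,
  and a fan outside \<open>A\<close> joins all exits to \<open>z\<close>.\<close>

lemma packing_two_one:
  assumes E: "sym E" and V: "finite V" and A: "A \<subseteq> V"
    and kA: "k_connected E A k" "k < card A" and kB: "k_connected E (V - A) k" and k0: "0 < k"
    and f: "\<And>a. a \<in> A \<Longrightarrow> f a \<in> V - A \<and> (a, f a) \<in> E" "inj_on f A"
    and xyz: "x \<in> A" "y \<in> A" "x \<noteq> y" "z \<in> V - A"
  shows "packing E V {x, y, z} k"
proof -
  let ?S = "{x, y, z}"
  let ?Ny = "{v \<in> A - {y}. (y, v) \<in> E}"
  have finA: "finite A" "finite (V - A)"
    using A V by (auto intro: finite_subset)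
  \<comment> \<open>One neighbour of \<open>y\<close> may be \<open>x\<close>, which leaves
    \<open>k - 1\<close> for certain; the last connection ends in \<open>y\<close> itself.\<close>
  have "k \<le> card ?Ny"
    by (rule k_connected_degree) (use kA finA xyz in auto)
  moreover have "card ?Ny - card {x} \<le> card (?Ny - {x})"
    by (rule diff_card_le_card_Diff) simp
  ultimately have "k - 1 \<le> card (?Ny - {x})" by simp
  then obtain N where N: "N \<subseteq> ?Ny - {x}" "card N = k - 1" "finite N"
    by (rule obtain_subset_with_card_n)
  define Y where "Y = insert y N"
  have Y: "Y \<subseteq> A" "finite Y" "card Y = k" "x \<notin> Y"
    using N xyz k0 by (auto simp: Y_def card_insert_if)
  obtain \<phi> where \<phi>: "\<And>t. t \<in> Y \<Longrightarrow> \<phi> t \<subseteq> A" "\<And>t. t \<in> Y \<Longrightarrow> x \<in> \<phi> t" "\<And>t. t \<in> Y \<Longrightarrow> t \<in> \<phi> t"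
    "\<And>t. t \<in> Y \<Longrightarrow> conn E (\<phi> t)"
    "\<And>t t'. t \<in> Y \<Longrightarrow> t' \<in> Y \<Longrightarrow> t \<noteq> t' \<Longrightarrow> \<phi> t \<inter> \<phi> t' = {x}"
    by (rule fan[OF E finA(1) kA(1) xyz(1), of Y]) (use Y in auto)
  \<comment> \<open>Since \<open>x\<close> is not in \<open>Y\<close>, redirecting \<open>y\<close>
    to \<open>x\<close> keeps the exits distinct.\<close>
  define e where "e t = (if t = y then x else t)" for t
  have eA: "e t \<in> A" if "t \<in> Y" for t
    using that Y xyz by (auto simp: e_def)
  have inj_fe: "inj_on (\<lambda>t. f (e t)) Y"
  proof (rule inj_onI)
    fix t t' assume t: "t \<in> Y" "t' \<in> Y" "f (e t) = f (e t')"
    then have "e t = e t'"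
      using inj_onD[OF f(2)] eA by blast
    then show "t = t'"
      using t(1,2) Y(4) by (auto simp: e_def split: if_splits)
  qed
  have "card ((\<lambda>t. f (e t)) ` Y - {z}) \<le> card ((\<lambda>t. f (e t)) ` Y)"
    by (rule card_Diff1_le)
  also have "\<dots> \<le> k"
    using Y(2,3) card_image_le by blast
  finally have card_fe: "card ((\<lambda>t. f (e t)) ` Y - {z}) \<le> k" .
  have sub_fe: "(\<lambda>t. f (e t)) ` Y \<subseteq> V - A"
    using f(1) eA by blast
  define Z where "Z = (\<lambda>t. f (e t)) ` Y"
  obtain \<psi> where \<psi>: "\<And>t. t \<in> Z \<Longrightarrow> \<psi> t \<subseteq> V - A" "\<And>t. t \<in> Z \<Longrightarrow> z \<in> \<psi> t" "\<And>t. t \<in> Z \<Longrightarrow> t \<in> \<psi> t"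
    "\<And>t. t \<in> Z \<Longrightarrow> conn E (\<psi> t)"
    "\<And>t t'. t \<in> Z \<Longrightarrow> t' \<in> Z \<Longrightarrow> t \<noteq> t' \<Longrightarrow> \<psi> t \<inter> \<psi> t' = {z}"
    by (rule fan[OF E finA(2) kB xyz(4), of Z]) (use sub_fe card_fe in \<open>auto simp: Z_def[symmetric]\<close>)
  define W where "W t = \<phi> t \<union> {y} \<union> \<psi> (f (e t))" for t
  \<comment> \<open>All edges between terminals go to the tree \<open>t = y\<close>. The other trees
    reach \<open>y\<close> and leave \<open>A\<close> by edges at the non-terminal \<open>t\<close>,
    and each of their fan pieces contains a single terminal.\<close>
  define F where "F t = (if t = y then E \<inter> ?S \<times> ?S else {})" for t
  have yY: "y \<in> Y" by (simp add: Y_def)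
  have y\<phi>: "y \<notin> \<phi> t" if "t \<in> Y" "t \<noteq> y" for t
    using \<phi>(5)[OF that(1) yY that(2)] \<phi>(3)[OF yY] xyz(3) by (metis IntI singletonD)
  show ?thesis
  proof (rule packingI[OF E Y(2,3), where W = W and F = F])
    fix t assume t: "t \<in> Y"
    let ?R = "(E - ?S \<times> ?S) \<union> F t"
    have symF: "sym (F t)"
    proof (rule symI)
      fix a b assume "(a, b) \<in> F t"
      then show "(b, a) \<in> F t"
        using symD[OF E, of a b] by (auto simp: F_def split: if_splits)
    qed
    have symR: "sym ?R"
    proof (rule symI)
      fix a b assume "(a, b) \<in> ?R"
      then show "(b, a) \<in> ?R"
        using symD[OF E, of a b] symD[OF symF, of a b] by blast
    qed
    have ft: "f (e t) \<in> Z" using t by (simp add: Z_def)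
    have \<psi>c: "conn ?R (\<psi> (f (e t)))"
    proof (rule conn_mono)
      show "conn (E - ?S \<times> ?S) (\<psi> (f (e t)))"
        by (rule conn_off_terminals[OF \<psi>(4)[OF ft], of _ z]) (use \<psi>(1)[OF ft] xyz in auto)
    qed auto
    have "conn ?R (W t)"
    proof (cases "t = y")
      case True
      then have R: "?R = E" by (auto simp: F_def)
      have "conn E (\<phi> y \<union> \<psi> (f (e y)))"
        using \<phi>(2,4)[OF yY] \<psi>(3,4)[OF ft] f(1)[OF xyz(1)] E True
        by (intro conn_edge_Un[of _ _ _ x "f x"]) (auto simp: e_def)
      moreover have "W t = \<phi> y \<union> \<psi> (f (e y))"
        using True \<phi>(3)[OF yY] by (auto simp: W_def)
      ultimately show ?thesis
        using R by simp
    next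
      case False
      then have tS: "t \<notin> ?S" "e t = t" "t \<in> N"
        using t Y xyz by (auto simp: e_def Y_def)
      have "conn (E - ?S \<times> ?S) (\<phi> t)"
        by (rule conn_off_terminals[OF \<phi>(4)[OF t], of _ x])
          (use \<phi>(1)[OF t] y\<phi>[OF t False] xyz in auto)
      then have "conn ?R (\<phi> t)"
        by (rule conn_mono) auto
      moreover have "(y, t) \<in> ?R"
        using tS N by auto
      ultimately have \<phi>c: "conn ?R ({y} \<union> \<phi> t)"
        using symR \<phi>(3)[OF t] by (intro conn_attach) auto
      have "t \<in> {y} \<union> \<phi> t" "f t \<in> \<psi> (f (e t))" "(t, f t) \<in> ?R"
        using tS f(1)[of t] t Y(1) \<phi>(3)[OF t] \<psi>(3)[OF ft] by auto
      then have "conn ?R (({y} \<union> \<phi> t) \<union> \<psi> (f (e t)))"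
        by (rule conn_edge_Un[OF \<phi>c \<psi>c symR])
      moreover have "W t = ({y} \<union> \<phi> t) \<union> \<psi> (f (e t))"
        by (auto simp: W_def)
      ultimately show ?thesis by simp
    qed
    then show "?S \<subseteq> W t \<and> W t \<subseteq> V \<and> conn ?R (W t)"
      using \<phi>(1,2)[OF t] \<psi>(1,2)[OF ft] A xyz by (auto simp: W_def)
    show "F t \<subseteq> E \<inter> ?S \<times> ?S \<and> sym (F t)"
      using symF by (auto simp: F_def split: if_splits)
  next
    fix t t' assume t: "t \<in> Y" "t' \<in> Y" "t \<noteq> t'"
    have "f (e t) \<noteq> f (e t')"
      using inj_fe t unfolding inj_on_def by blast
    then have "\<psi> (f (e t)) \<inter> \<psi> (f (e t')) = {z}"
      using t by (intro \<psi>(5)) (auto simp: Z_def)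
    moreover have "\<phi> t \<inter> \<phi> t' = {x}"
      using t by (rule \<phi>(5))
    moreover have "\<phi> t \<subseteq> A" "\<phi> t' \<subseteq> A" "\<psi> (f (e t)) \<subseteq> V - A" "\<psi> (f (e t')) \<subseteq> V - A"
      using \<phi>(1) \<psi>(1) t by (simp_all add: Z_def)
    ultimately have "W t \<inter> W t' = ?S"
      using xyz unfolding W_def by blast
    moreover have "F t \<inter> F t' = {}"
      using t by (auto simp: F_def)
    ultimately show "W t \<inter> W t' = ?S \<and> F t \<inter> F t' = {}" ..
  qed
qed

section \<open>Clustered graphs\<close>

lemma conn_UN:
  assumes "T \<noteq> {}" "\<And>t. t \<in> T \<Longrightarrow> conn R (\<phi> t)" "\<And>t. t \<in> T \<Longrightarrow> r \<in> \<phi> t"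
  shows "conn R (\<Union>(\<phi> ` T))"
proof (rule connI)
  show "\<Union>(\<phi> ` T) \<noteq> {}"
    using assms(1,3) by blast
next
  fix D assume D: "D \<subseteq> \<Union>(\<phi> ` T)" "D \<noteq> {}" "D \<noteq> \<Union>(\<phi> ` T)"
  have "\<exists>t\<in>T. D \<inter> \<phi> t \<noteq> {} \<and> \<not> \<phi> t \<subseteq> D"
  proof (cases "r \<in> D")
    case True
    then show ?thesis
      using D assms(3) by blast
  next
    case False
    then show ?thesis
      using D assms(3) by blast
  qed
  then obtain t where t: "t \<in> T" "D \<inter> \<phi> t \<noteq> {}" "\<not> \<phi> t \<subseteq> D" by blast
  then show "\<exists>u\<in>D. \<exists>v\<in>\<Union>(\<phi> ` T) - D. (u, v) \<in> R"
    using connD[OF assms(2)[OF t(1)] t(2,3)] by blast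
qed

text \<open>\<open>f\<close> stands for right multiplication by the last generator.
  \<open>V_large\<close> excludes parts that are \<open>k\<close>-connected merely for lack of
  vertices.\<close>

locale clusters =
  fixes E :: "'a rel" and J :: "'i set" and V :: "'i \<Rightarrow> 'a set" and f :: "'a \<Rightarrow> 'a" and k :: nat
  assumes sym_E: "sym E"
    and finite_J: "finite J" and card_J: "card J = Suc k" and k_ge: "3 \<le> k"
    and finite_V: "\<And>i. i \<in> J \<Longrightarrow> finite (V i)"
    and V_connected: "\<And>i. i \<in> J \<Longrightarrow> k_connected E (V i) k"
    and V_large: "\<And>i. i \<in> J \<Longrightarrow> k < card (V i)"
    and V_disjoint: "\<And>i j. i \<in> J \<Longrightarrow> j \<in> J \<Longrightarrow> i \<noteq> j \<Longrightarrow> V i \<inter> V j = {}"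
    and f_leaves: "\<And>i v. i \<in> J \<Longrightarrow> v \<in> V i \<Longrightarrow> \<exists>j\<in>J - {i}. f v \<in> V j"
    and f_f: "\<And>i v. i \<in> J \<Longrightarrow> v \<in> V i \<Longrightarrow> f (f v) = v"
    and f_edge: "\<And>i v. i \<in> J \<Longrightarrow> v \<in> V i \<Longrightarrow> (v, f v) \<in> E"
    and exits: "\<And>i j. i \<in> J \<Longrightarrow> j \<in> J \<Longrightarrow> i \<noteq> j \<Longrightarrow> 2 \<le> card {v \<in> V i. f v \<in> V j}"
begin

section \<open>Connectivity of unions of parts\<close>

lemma V_unique: "i \<in> J \<Longrightarrow> j \<in> J \<Longrightarrow> v \<in> V i \<Longrightarrow> v \<in> V j \<Longrightarrow> i = j"
  using V_disjoint by blast

lemma V_nonempty: "i \<in> J \<Longrightarrow> V i \<noteq> {}"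
  using V_large[of i] by auto

lemma f_edge': "i \<in> J \<Longrightarrow> v \<in> V i \<Longrightarrow> (f v, v) \<in> E"
  using f_edge sym_E by (auto dest: symD)

text \<open>Every matching edge from a part in \<open>I\<close> to a part in \<open>L\<close> has an
  end in the separator, matching edges have no common ends, and there are at least two for each pair
  of parts.\<close>

lemma cut_edges:
  assumes M: "M \<subseteq> J" and sep: "separation E (\<Union>(V ` M)) P Q"
    and IL: "I \<union> L = M" "I \<inter> L = {}"
    and I: "\<And>i. i \<in> I \<Longrightarrow> V i \<subseteq> P" and L: "\<And>i. i \<in> L \<Longrightarrow> V i \<subseteq> Q"
  shows "2 * (card I * card L) \<le> card (P \<inter> Q)"
proof -
  have fin: "finite I" "finite L"
    using finite_J M IL by (auto intro: finite_subset)
  have JIL: "I \<subseteq> J" "L \<subseteq> J"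
    using M IL by auto
  have finPQ: "finite (P \<inter> Q)"
  proof -
    have "finite (\<Union>(V ` M))"
      using finite_V M finite_J by (auto intro: finite_subset)
    then show ?thesis
      using sep unfolding separation_def by (metis finite_Int finite_Un)
  qed
  define X where "X ij = {v \<in> V (fst ij). f v \<in> V (snd ij)}" for ij
  define U where "U = \<Union>(X ` (I \<times> L))"
  have "card U = (\<Sum>ij\<in>I \<times> L. card (X ij))"
    unfolding U_def
  proof (rule card_UN_disjoint)
    show "\<forall>ij\<in>I \<times> L. finite (X ij)"
      using finite_V JIL by (auto simp: X_def)
    show "\<forall>ij\<in>I \<times> L. \<forall>ij'\<in>I \<times> L. ij \<noteq> ij' \<longrightarrow> X ij \<inter> X ij' = {}"
    proof (intro ballI impI)
      fix ij ij' assume *: "ij \<in> I \<times> L" "ij' \<in> I \<times> L" "ij \<noteq> ij'"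
      then have "fst ij \<in> J" "fst ij' \<in> J" "snd ij \<in> J" "snd ij' \<in> J"
        using JIL by auto
      then show "X ij \<inter> X ij' = {}"
        using *(3) V_disjoint unfolding X_def by (auto simp: prod_eq_iff dest: V_unique)
    qed
  qed (use fin in auto)
  also have "\<dots> \<ge> (\<Sum>ij\<in>I \<times> L. 2)"
  proof (rule sum_mono)
    fix ij assume "ij \<in> I \<times> L"
    then show "2 \<le> card (X ij)"
      unfolding X_def using JIL IL by (intro exits) auto
  qed
  finally have cU: "2 * (card I * card L) \<le> card U"
    by (simp add: card_cartesian_product)
  have U: "\<exists>i\<in>I. \<exists>j\<in>L. v \<in> V i \<and> f v \<in> V j" if "v \<in> U" for v
    using that unfolding U_def X_def by auto
  \<comment> \<open>If \<open>v\<close> is outside \<open>Q\<close>, its edge to \<open>f v\<close>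
    forces \<open>f v\<close> into \<open>P\<close>. Injectivity holds because \<open>f\<close> is
    an involution and a vertex \<open>v\<close> of \<open>U\<close> lies in a part of
    \<open>I\<close>, whereas each \<open>f w\<close> lies in a part of \<open>L\<close>.\<close>
  define g where "g v = (if v \<in> Q then v else f v)" for v
  have "card U \<le> card (P \<inter> Q)"
  proof (rule card_inj_on_le[OF _ _ finPQ])
    show "g ` U \<subseteq> P \<inter> Q"
    proof
      fix w assume "w \<in> g ` U"
      then obtain v where v: "v \<in> U" "w = g v" by blast
      then obtain i j where ij: "i \<in> I" "j \<in> L" "v \<in> V i" "f v \<in> V j"
        using U by blast
      then have vP: "v \<in> P" "f v \<in> Q" "(v, f v) \<in> E"
        using I L f_edge JIL by blast+
      then show "w \<in> P \<inter> Q"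
        using sep v(2) unfolding separation_def g_def by auto
    qed
    show "inj_on g U"
    proof (rule inj_onI)
      fix v w assume vw: "v \<in> U" "w \<in> U" "g v = g w"
      obtain i j where ij: "i \<in> I" "j \<in> L" "v \<in> V i" "f v \<in> V j"
        using U[OF vw(1)] by blast
      obtain i' j' where ij': "i' \<in> I" "j' \<in> L" "w \<in> V i'" "f w \<in> V j'"
        using U[OF vw(2)] by blast
      have "v \<noteq> f w" "w \<noteq> f v"
        using ij ij' V_unique[of i j' v] V_unique[of i' j w] IL(2) JIL by auto
      moreover have "f (f v) = v" "f (f w) = w"
        using f_f ij ij' JIL by blast+
      ultimately show "v = w"
        using vw(3) unfolding g_def by (metis (full_types))
    qed
  qed
  then show ?thesis
    using cU by linarith
qed

text \<open>A separator that is small inside each part splits none of them, so each part lies within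
  \<open>P\<close> or within \<open>Q\<close>, and the matching edges between the two kinds can be
  counted.\<close>

lemma card_parts_le_separator:
  assumes M: "M \<subseteq> J" and sep: "separation E (\<Union>(V ` M)) P Q" and ne: "P - Q \<noteq> {}" "Q - P \<noteq> {}"
    and small: "\<And>i. i \<in> M \<Longrightarrow> card (V i \<inter> (P \<inter> Q)) < k"
  shows "card M \<le> card (P \<inter> Q)"
proof -
  have side: "V i \<subseteq> P \<or> V i \<subseteq> Q" if "i \<in> M" for i
  proof (rule ccontr)
    assume neg: "\<not> ?thesis"
    have kc: "k_connected E (V i) k"
      using that M V_connected by blast
    have Vi: "V i \<subseteq> P \<union> Q"
      using sep that unfolding separation_def by auto
    have "separation E (V i) (V i \<inter> P) (V i \<inter> Q)"
      using sep Vi unfolding separation_def by blast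
    then have "k \<le> card ((V i \<inter> P) \<inter> (V i \<inter> Q))"
      by (rule k_connectedD[OF kc]) (use neg Vi in blast)+
    moreover have "(V i \<inter> P) \<inter> (V i \<inter> Q) = V i \<inter> (P \<inter> Q)" by blast
    ultimately show False
      using small[OF that] by simp
  qed
  define I where "I = {i \<in> M. V i \<subseteq> P}"
  define L where "L = M - I"
  have fin: "finite I" "finite L"
    using finite_J M by (auto simp: I_def L_def intro: finite_subset)
  have PQ: "P \<union> Q = \<Union>(V ` M)"
    using sep unfolding separation_def by blast
  have "2 * (card I * card L) \<le> card (P \<inter> Q)"
    by (rule cut_edges[OF M sep]) (use side in \<open>auto simp: I_def L_def\<close>)
  moreover have "I \<noteq> {}"
  proof
    assume "I = {}"
    then have "\<Union>(V ` M) \<subseteq> Q"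
      using side unfolding I_def by blast
    then show False
      using PQ ne(1) by blast
  qed
  moreover have "L \<noteq> {}"
  proof
    assume "L = {}"
    then have "\<Union>(V ` M) \<subseteq> P"
      unfolding I_def L_def by blast
    then show False
      using PQ ne(2) by blast
  qed
  moreover have "card M = card I + card L"
  proof -
    have "M = I \<union> L" "I \<inter> L = {}"
      by (auto simp: I_def L_def)
    then show ?thesis
      using fin by (simp add: card_Un_disjoint)
  qed
  moreover have "p + q \<le> 2 * (p * q)" if "0 < p" "0 < q" for p q :: nat
  proof -
    have "p * 1 \<le> p * q" "1 * q \<le> p * q"
      using that by (intro mult_le_mono; simp)+
    then show ?thesis by linarith
  qed
  ultimately show ?thesis
    using fin by (metis card_gt_0_iff le_trans)
qed

text \<open>With \<open>k\<close> parts left, a separator of fewer than \<open>k\<close> vertices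
  would be small in each part and yet have at least \<open>k\<close> elements.\<close>

lemma union_minus_one_connected:
  assumes c: "c \<in> J"
  shows "k_connected E (\<Union>(V ` (J - {c}))) k"
  unfolding k_connected_def
proof (intro allI impI)
  fix P Q assume PQ: "separation E (\<Union>(V ` (J - {c}))) P Q" "P - Q \<noteq> {}" "Q - P \<noteq> {}"
  show "k \<le> card (P \<inter> Q)"
  proof (rule ccontr)
    assume neg: "\<not> ?thesis"
    have fin: "finite (P \<inter> Q)"
      using PQ(1) finite_V finite_J unfolding separation_def
      by (metis finite_Int finite_Un finite_UN Diff_iff finite_Diff)
    have "card (J - {c}) \<le> card (P \<inter> Q)"
    proof (rule card_parts_le_separator[OF _ PQ])
      fix i
      have "card (V i \<inter> (P \<inter> Q)) \<le> card (P \<inter> Q)"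
        using fin by (intro card_mono) auto
      then show "card (V i \<inter> (P \<inter> Q)) < k"
        using neg by linarith
    qed auto
    then show False
      using neg c card_J finite_J by simp
  qed
qed

lemma union_minus_one_conn: "c \<in> J \<Longrightarrow> conn E (\<Union>(V ` (J - {c})))"
proof (rule k_connected_imp_conn)
  assume c: "c \<in> J"
  then show "k_connected E (\<Union>(V ` (J - {c}))) k"
    by (rule union_minus_one_connected)
  have "J - {c} \<noteq> {}"
  proof
    assume "J - {c} = {}"
    then have "card (J - {c}) = 0" by (simp only: card.empty)
    then show False
      using c card_J finite_J k_ge by simp
  qed
  then show "\<Union>(V ` (J - {c})) \<noteq> {}"
    using V_nonempty by blast
qed (use k_ge in simp)

text \<open>A separator of at most \<open>k\<close> vertices that is not small in every part lies
  inside a single \<open>V i\<close>. The other parts together stay connected and untouched, and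
  every vertex of \<open>V i\<close> has its partner there, so nothing is separated.\<close>

lemma union_connected: "k_connected E (\<Union>(V ` J)) (Suc k)"
  unfolding k_connected_def
proof (intro allI impI)
  fix P Q assume PQ: "separation E (\<Union>(V ` J)) P Q" "P - Q \<noteq> {}" "Q - P \<noteq> {}"
  have fin: "finite (P \<inter> Q)"
    using PQ(1) finite_V finite_J unfolding separation_def
    by (metis finite_Int finite_Un finite_UN)
  have PQV: "P \<union> Q = \<Union>(V ` J)"
    using PQ(1) unfolding separation_def by blast
  have noedge: "(u, v) \<notin> E" "(v, u) \<notin> E" if "u \<in> P - Q" "v \<in> Q - P" for u v
    using that PQ(1) sym_E unfolding separation_def by (auto dest: symD)
  show "Suc k \<le> card (P \<inter> Q)"
  proof (rule ccontr)
    assume neg: "\<not> ?thesis"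
    have "\<exists>i\<in>J. \<not> card (V i \<inter> (P \<inter> Q)) < k"
    proof (rule ccontr)
      assume "\<not> ?thesis"
      then have "card J \<le> card (P \<inter> Q)"
        by (intro card_parts_le_separator[OF _ PQ]) auto
      then show False
        using neg card_J by simp
    qed
    then obtain i where i: "i \<in> J" "k \<le> card (V i \<inter> (P \<inter> Q))"
      by force
    have "V i \<inter> (P \<inter> Q) = P \<inter> Q"
      by (rule card_seteq[OF fin]) (use i neg in auto)
    then have PQi: "P \<inter> Q \<subseteq> V i" by blast
    let ?U = "\<Union>(V ` (J - {i}))"
    have U: "?U \<inter> (P \<inter> Q) = {}" "?U \<subseteq> P \<union> Q"
      using PQi PQV V_disjoint i(1) by blast+
    have out: "f v \<in> ?U" "(v, f v) \<in> E" if "v \<in> V i" for v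
      using f_leaves[OF i(1) that] f_edge[OF i(1) that] by blast+
    have "?U \<subseteq> P \<or> ?U \<inter> P = {}"
    proof (rule ccontr)
      assume "\<not> ?thesis"
      then have "\<exists>u\<in>P \<inter> ?U. \<exists>v\<in>?U - P. (u, v) \<in> E"
        by (intro connD[OF union_minus_one_conn[OF i(1)]]) auto
      then show False
        using U noedge(1) by blast
    qed
    then show False
    proof
      assume UP: "?U \<subseteq> P"
      then obtain q where q: "q \<in> Q - P" "q \<in> V i"
        using PQ(3) PQV by blast
      then show False
        using out[of q] noedge(2)[of "f q" q] UP U by blast
    next
      assume UP: "?U \<inter> P = {}"
      then obtain p where p: "p \<in> P - Q" "p \<in> V i"
        using PQ(2) PQV by blast
      then show False
        using out[of p] noedge(1)[of p "f p"] UP U by blast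
    qed
  qed
qed

section \<open>Packings in unions of parts\<close>

lemma packing_two_parts:
  assumes a: "a \<in> J" "x \<in> V a" "y \<in> V a" "x \<noteq> y" and z: "z \<in> \<Union>(V ` J)" "z \<notin> V a"
  shows "packing E (\<Union>(V ` J)) {x, y, z} k"
proof (rule packing_two_one[where A = "V a" and f = f])
  have rest: "\<Union>(V ` J) - V a = \<Union>(V ` (J - {a}))"
    using V_disjoint a(1) by blast
  show "k_connected E (\<Union>(V ` J) - V a) k"
    unfolding rest by (rule union_minus_one_connected[OF a(1)])
  show "f v \<in> \<Union>(V ` J) - V a \<and> (v, f v) \<in> E" if "v \<in> V a" for v
    unfolding rest using f_leaves[OF a(1) that] f_edge[OF a(1) that] by blast
  show "inj_on f (V a)"
    using f_f[OF a(1)] by (metis inj_onI)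
  show "finite (\<Union>(V ` J))"
    using finite_J finite_V by auto
qed (use a z sym_E V_connected V_large k_ge in auto)

text \<open>Three terminals in three different parts. Every part without a terminal is the hub of one
  tree. Two further trees, indexed by \<open>a\<close> and \<open>b\<close>, are \<open>x\<close>-\<open>y\<close>-\<open>z\<close> and \<open>x\<close>-\<open>z\<close>-\<open>y\<close>. This takes
  \<open>k\<close> exits from the part of \<open>x\<close>, but \<open>k + 1\<close> exits from the parts of \<open>y\<close> and of \<open>z\<close>; so the exits
  are chosen such that the terminals \<open>y\<close> and \<open>z\<close> themselves serve as exits, which leaves \<open>k\<close>
  targets for each fan.\<close>

lemma packing_three_parts:
  assumes J: "a \<in> J" "b \<in> J" "c \<in> J" "a \<noteq> b" "a \<noteq> c" "b \<noteq> c"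
    and x: "x \<in> V a" and y: "y \<in> V b" and z: "z \<in> V c"
  shows "packing E (\<Union>(V ` J)) {x, y, z} k"
proof -
  let ?S = "{x, y, z}"
  have distinct: "x \<noteq> y" "x \<noteq> z" "y \<noteq> z"
    using V_unique J x y z by metis+
  define J' where "J' = J - {a, b, c}"
  have J': "J' \<subseteq> J" "a \<notin> J'" "b \<notin> J'" "c \<notin> J'" "finite J'"
    using finite_J by (auto simp: J'_def)
  have cJ': "card J' = k - 2"
  proof -
    have "card J' = card J - card {a, b, c}"
      unfolding J'_def using J finite_J by (intro card_Diff_subset) auto
    then show ?thesis
      using J card_J by simp
  qed
  \<comment> \<open>If \<open>w\<close> is itself an exit from part \<open>i\<close> to part
    \<open>j\<close>, it is the one chosen; \<open>w\<close> will be the terminal of part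
    \<open>i\<close>.\<close>
  have exit: "\<exists>v. v \<in> V i \<and> f v \<in> V j \<and> (w \<in> V i \<longrightarrow> f w \<in> V j \<longrightarrow> v = w)"
    if "i \<in> J" "j \<in> J" "i \<noteq> j" for i j w
  proof (cases "w \<in> V i \<and> f w \<in> V j")
    case False
    have "{v \<in> V i. f v \<in> V j} \<noteq> {}"
      using exits[OF that] by (metis card.empty not_numeral_le_zero)
    then show ?thesis
      using False by blast
  qed blast
  have "\<forall>j\<in>J - {i}. \<exists>v. v \<in> V i \<and> f v \<in> V j \<and> (w \<in> V i \<longrightarrow> f w \<in> V j \<longrightarrow> v = w)"
    if "i \<in> J" for i w
    using exit that by blast
  note choice = bchoice[OF this]
  obtain eA where eA: "\<forall>j\<in>J - {a}. eA j \<in> V a \<and> f (eA j) \<in> V j \<and> (x \<in> V a \<longrightarrow> f x \<in> V j \<longrightarrow> eA j = x)"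
    using choice[OF J(1), of x] by blast
  obtain eB where eB: "\<forall>j\<in>J - {b}. eB j \<in> V b \<and> f (eB j) \<in> V j \<and> (y \<in> V b \<longrightarrow> f y \<in> V j \<longrightarrow> eB j = y)"
    using choice[OF J(2), of y] by blast
  obtain eC where eC: "\<forall>j\<in>J - {c}. eC j \<in> V c \<and> f (eC j) \<in> V j \<and> (z \<in> V c \<longrightarrow> f z \<in> V j \<longrightarrow> eC j = z)"
    using choice[OF J(3), of z] by blast
  \<comment> \<open>\<open>p\<close> and \<open>q\<close> lead into the part of \<open>x\<close>;
    tree \<open>a\<close> uses the matching edge at \<open>p\<close>, tree \<open>b\<close> the one
    at \<open>q\<close>.\<close>
  define p where "p = eB a"
  define q where "q = eC a"
  have p: "p \<in> V b" "f p \<in> V a" "f y \<in> V a \<Longrightarrow> p = y"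
    using eB J y unfolding p_def by auto
  have q: "q \<in> V c" "f q \<in> V a" "f z \<in> V a \<Longrightarrow> q = z"
    using eC J z unfolding q_def by auto
  define M where "M = {v \<in> V b. f v \<in> V c}"
  have M2: "2 \<le> card M"
    unfolding M_def using J by (intro exits) auto
  obtain s1 where s1: "s1 \<in> M" "y \<in> M \<Longrightarrow> s1 = y"
    using exit[OF J(2,3,6), of y] unfolding M_def by blast
  have "M - {s1} \<noteq> {}"
  proof
    assume "M - {s1} = {}"
    then have "M \<subseteq> {s1}" by blast
    then show False
      using M2 card_mono[of "{s1}" M] by simp
  qed
  \<comment> \<open>Both trees need an edge between the parts of \<open>y\<close> and
    \<open>z\<close>: tree \<open>a\<close> takes it at \<open>s1\<close>, tree \<open>b\<close> at
    \<open>s2\<close>. If the partner of \<open>z\<close> lies in the part of \<open>y\<close>, it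
    is made one of the two, so that \<open>z\<close> is an exit. Moreover \<open>s2\<close> is never
    \<open>y\<close>, which would have been taken for \<open>s1\<close>.\<close>
  then obtain s2 where s2: "s2 \<in> M" "s2 \<noteq> s1" "f z \<in> M \<Longrightarrow> f z \<in> {s1, s2}"
    by (metis Diff_iff all_not_in_conv insert_iff)
  have s: "s1 \<in> V b" "f s1 \<in> V c" "s2 \<in> V b" "f s2 \<in> V c" "s2 \<noteq> y"
    using s1 s2 unfolding M_def by auto
  have ff: "f (f p) = p" "f (f q) = q" "f (f s1) = s1" "f (f s2) = s2" "f (f z) = z" "f (f y) = y"
    using f_f J p q s y z by blast+
  have eA': "eA j \<in> V a" "f (eA j) \<in> V j" "f (f (eA j)) = eA j" if "j \<in> J'" for j
    using eA that f_f J unfolding J'_def by auto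
  have eB': "eB j \<in> V b" "f (eB j) \<in> V j" "f y \<in> V j \<Longrightarrow> eB j = y" if "j \<in> J'" for j
    using eB that y unfolding J'_def by auto
  have eC': "eC j \<in> V c" "f (eC j) \<in> V j" "f z \<in> V j \<Longrightarrow> eC j = z" if "j \<in> J'" for j
    using eC that z unfolding J'_def by auto
  \<comment> \<open>\<open>\<alpha> j\<close>, \<open>\<beta> j\<close>, \<open>\<gamma> j\<close>
    hold the exits of tree \<open>j\<close> from the parts of \<open>x\<close>, \<open>y\<close>,
    \<open>z\<close>, and \<open>\<delta> j\<close> is its hub. Tree \<open>a\<close> runs through
    \<open>x\<close>, \<open>f p\<close>, \<open>p\<close>, \<open>y\<close>, \<open>s1\<close>,
    \<open>f s1\<close>, \<open>z\<close>; tree \<open>b\<close> through \<open>x\<close>,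
    \<open>f q\<close>, \<open>q\<close>, \<open>z\<close>, \<open>f s2\<close>, \<open>s2\<close>,
    \<open>y\<close>.\<close>
  define \<alpha> where "\<alpha> j = (if j = a then {f p} else if j = b then {f q} else {eA j})" for j
  define \<beta> where "\<beta> j = (if j = a then {p, s1} else if j = b then {s2} else {eB j})" for j
  define \<gamma> where "\<gamma> j = (if j = a then {f s1} else if j = b then {q, f s2} else {eC j})" for j
  define \<delta> where "\<delta> j = (if j \<in> J' then V j else {})" for j
  define I where "I = insert a (insert b J')"
  have I: "finite I" "card I = k"
    using J' cJ' J k_ge by (auto simp: I_def)
  have I_cases: "P i" if "i \<in> I" "P a" "P b" "\<And>j. j \<in> J' \<Longrightarrow> P j" for P i
    using that unfolding I_def by auto
  have \<alpha>J': "\<alpha> j = {eA j}" "\<beta> j = {eB j}" "\<gamma> j = {eC j}" "\<delta> j = V j" if "j \<in> J'" for j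
    using that J' by (auto simp: \<alpha>_def \<beta>_def \<gamma>_def \<delta>_def)
  have \<alpha>a: "\<alpha> a = {f p}" "\<beta> a = {p, s1}" "\<gamma> a = {f s1}" "\<delta> a = {}"
    using J' by (auto simp: \<alpha>_def \<beta>_def \<gamma>_def \<delta>_def)
  have \<alpha>b: "\<alpha> b = {f q}" "\<beta> b = {s2}" "\<gamma> b = {q, f s2}" "\<delta> b = {}"
    using J' J by (auto simp: \<alpha>_def \<beta>_def \<gamma>_def \<delta>_def)
  define YA where "YA = \<Union>(\<alpha> ` I)"
  define YB where "YB = \<Union>(\<beta> ` I)"
  define YC where "YC = \<Union>(\<gamma> ` I)"
  have YA: "YA = {f p, f q} \<union> eA ` J'" and YB: "YB = {p, s1, s2} \<union> eB ` J'"
    and YC: "YC = {f s1, q, f s2} \<union> eC ` J'"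
    unfolding YA_def YB_def YC_def I_def using \<alpha>J' \<alpha>a \<alpha>b by auto
  have YV: "YA \<subseteq> V a" "YB \<subseteq> V b" "YC \<subseteq> V c"
    unfolding YA YB YC using p q s eA' eB' eC' by auto
  have cYA: "card (YA - {x}) \<le> k"
  proof -
    have "card (YA - {x}) \<le> card YA"
      by (rule card_Diff1_le)
    also have "\<dots> \<le> card {f p, f q} + card (eA ` J')"
      unfolding YA by (rule card_Un_le)
    also have "\<dots> \<le> 2 + card J'"
      using J' by (intro add_mono card_image_le) (auto simp: card_insert_if)
    finally show ?thesis
      using cJ' k_ge by simp
  qed
  \<comment> \<open>Three exits for the trees \<open>a\<close> and \<open>b\<close> and one for each
    of the \<open>k - 2\<close> hubs make up to \<open>k + 1\<close> targets; removing the terminal,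
    which is among them, leaves \<open>k\<close>.\<close>
  have minus_one: "card (({u, v, w} \<union> g ` J') - {t}) \<le> k" if "t \<in> {u, v, w} \<union> g ` J'"
    for u v w t :: 'a and g
  proof -
    have "card ({u, v, w} \<union> g ` J') \<le> card {u, v, w} + card (g ` J')"
      by (rule card_Un_le)
    also have "\<dots> \<le> 3 + card J'"
      using J' by (intro add_mono card_image_le) (auto simp: card_insert_if)
    finally have "card ({u, v, w} \<union> g ` J') \<le> Suc k"
      using cJ' k_ge by simp
    then show ?thesis
      using that J' by (subst card_Diff_singleton) auto
  qed
  \<comment> \<open>The partner of \<open>y\<close> lies in the part of \<open>x\<close>, in the
    part of \<open>z\<close> or in a hub, and in each case the preferred exit is
    \<open>y\<close>.\<close>
  have "y \<in> YB"
  proof -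
    obtain j where j: "j \<in> J - {b}" "f y \<in> V j"
      using f_leaves[OF J(2) y] by blast
    then consider "j = a" | "j = c" | "j \<in> J'"
      unfolding J'_def by blast
    then show ?thesis
      using j p(3) s1 y eB'(3) by cases (auto simp: YB M_def)
  qed
  then have cYB: "card (YB - {y}) \<le> k"
    unfolding YB by (rule minus_one)
  have "z \<in> YC"
  proof -
    obtain j where j: "j \<in> J - {c}" "f z \<in> V j"
      using f_leaves[OF J(3) z] by blast
    then consider "j = a" | "j = b" | "j \<in> J'"
      unfolding J'_def by blast
    then show ?thesis
    proof cases
      case 2
      then have "f z \<in> {s1, s2}"
        using j z ff by (intro s2(3)) (auto simp: M_def)
      then have "z \<in> {f s1, f s2}"
        using ff(5) by auto
      then show ?thesis
        by (auto simp: YC)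
    qed (use j q(3) eC'(3) in \<open>auto simp: YC\<close>)
  qed
  then have cYC: "card (YC - {z}) \<le> k"
    unfolding YC by (rule minus_one)
  obtain \<phi>A where A: "\<And>t. t \<in> YA \<Longrightarrow> \<phi>A t \<subseteq> V a" "\<And>t. t \<in> YA \<Longrightarrow> x \<in> \<phi>A t"
    "\<And>t. t \<in> YA \<Longrightarrow> t \<in> \<phi>A t" "\<And>t. t \<in> YA \<Longrightarrow> conn E (\<phi>A t)"
    "\<And>t t'. t \<in> YA \<Longrightarrow> t' \<in> YA \<Longrightarrow> t \<noteq> t' \<Longrightarrow> \<phi>A t \<inter> \<phi>A t' = {x}"
    by (rule fan[OF sym_E finite_V[OF J(1)] V_connected[OF J(1)] x YV(1) cYA]) blast
  obtain \<phi>B where B: "\<And>t. t \<in> YB \<Longrightarrow> \<phi>B t \<subseteq> V b" "\<And>t. t \<in> YB \<Longrightarrow> y \<in> \<phi>B t"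
    "\<And>t. t \<in> YB \<Longrightarrow> t \<in> \<phi>B t" "\<And>t. t \<in> YB \<Longrightarrow> conn E (\<phi>B t)"
    "\<And>t t'. t \<in> YB \<Longrightarrow> t' \<in> YB \<Longrightarrow> t \<noteq> t' \<Longrightarrow> \<phi>B t \<inter> \<phi>B t' = {y}"
    by (rule fan[OF sym_E finite_V[OF J(2)] V_connected[OF J(2)] y YV(2) cYB]) blast
  obtain \<phi>C where C: "\<And>t. t \<in> YC \<Longrightarrow> \<phi>C t \<subseteq> V c" "\<And>t. t \<in> YC \<Longrightarrow> z \<in> \<phi>C t"
    "\<And>t. t \<in> YC \<Longrightarrow> t \<in> \<phi>C t" "\<And>t. t \<in> YC \<Longrightarrow> conn E (\<phi>C t)"
    "\<And>t t'. t \<in> YC \<Longrightarrow> t' \<in> YC \<Longrightarrow> t \<noteq> t' \<Longrightarrow> \<phi>C t \<inter> \<phi>C t' = {z}"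
    by (rule fan[OF sym_E finite_V[OF J(3)] V_connected[OF J(3)] z YV(3) cYC]) blast
  define PA where "PA j = \<Union>(\<phi>A ` \<alpha> j)" for j
  define PB where "PB j = \<Union>(\<phi>B ` \<beta> j)" for j
  define PC where "PC j = \<Union>(\<phi>C ` \<gamma> j)" for j
  define W where "W j = PA j \<union> PB j \<union> PC j \<union> \<delta> j" for j
  \<comment> \<open>Tree \<open>a\<close> may need the edges \<open>xy\<close> and
    \<open>yz\<close>, and tree \<open>b\<close> only \<open>xz\<close>: its edge between the parts
    of \<open>y\<close> and \<open>z\<close> is at \<open>s2\<close>, which is not \<open>y\<close>.
    Hub trees need none.\<close>
  define F where "F j = (if j = a then E \<inter> {(x, y), (y, x), (y, z), (z, y)}
    else if j = b then E \<inter> {(x, z), (z, x)} else {})" for j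
  define R where "R j = (E - ?S \<times> ?S) \<union> F j" for j
  have symF: "sym (F j)" for j
  proof (rule symI)
    fix u v assume "(u, v) \<in> F j"
    then show "(v, u) \<in> F j"
      using symD[OF sym_E, of u v] by (auto simp: F_def split: if_splits)
  qed
  have symR: "sym (R j)" for j
  proof (rule symI)
    fix u v assume "(u, v) \<in> R j"
    then show "(v, u) \<in> R j"
      using symD[OF sym_E, of u v] symD[OF symF, of u v j] unfolding R_def by blast
  qed
  have targets: "\<alpha> j \<subseteq> YA" "\<beta> j \<subseteq> YB" "\<gamma> j \<subseteq> YC" "\<alpha> j \<noteq> {}" "\<beta> j \<noteq> {}" "\<gamma> j \<noteq> {}" if "j \<in> I" for j
    using that unfolding YA_def YB_def YC_def by (auto simp: \<alpha>_def \<beta>_def \<gamma>_def)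
  have span: "\<Union>(\<phi> ` T) \<subseteq> X \<and> r \<in> \<Union>(\<phi> ` T) \<and> T \<subseteq> \<Union>(\<phi> ` T)"
    if "T \<subseteq> Y" "T \<noteq> {}" "\<And>t. t \<in> Y \<Longrightarrow> \<phi> t \<subseteq> X" "\<And>t. t \<in> Y \<Longrightarrow> r \<in> \<phi> t" "\<And>t. t \<in> Y \<Longrightarrow> t \<in> \<phi> t"
    for \<phi> :: "'a \<Rightarrow> 'a set" and T X Y r
    using that by blast
  have PV: "PA j \<subseteq> V a" "PB j \<subseteq> V b" "PC j \<subseteq> V c" "x \<in> PA j" "y \<in> PB j" "z \<in> PC j"
    "\<alpha> j \<subseteq> PA j" "\<beta> j \<subseteq> PB j" "\<gamma> j \<subseteq> PC j" if "j \<in> I" for j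
    using span[OF targets(1,4)[OF that] A(1-3)] span[OF targets(2,5)[OF that] B(1-3)]
      span[OF targets(3,6)[OF that] C(1-3)]
    unfolding PA_def PB_def PC_def by simp_all
  have notS: "V a \<inter> ?S \<subseteq> {x}" "V b \<inter> ?S \<subseteq> {y}" "V c \<inter> ?S \<subseteq> {z}"
    using V_disjoint J x y z by blast+
  have R_mono: "conn (R j) X" if "conn E X" "X \<inter> ?S \<subseteq> {r}" for j X r
    by (rule conn_mono[OF conn_off_terminals[OF that]]) (auto simp: R_def)
  have conn_A: "conn (R j) (PA j)" if "j \<in> I" for j
    unfolding PA_def
  proof (rule conn_UN[where r = x])
    fix t assume "t \<in> \<alpha> j"
    then have t: "t \<in> YA" using targets(1)[OF that] by blast
    show "conn (R j) (\<phi>A t)"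
      by (rule R_mono[OF A(4)[OF t], of x]) (use A(1)[OF t] notS in blast)
    show "x \<in> \<phi>A t" by (rule A(2)[OF t])
  qed (rule targets(4)[OF that])
  have conn_B: "conn (R j) (PB j)" if "j \<in> I" for j
    unfolding PB_def
  proof (rule conn_UN[where r = y])
    fix t assume "t \<in> \<beta> j"
    then have t: "t \<in> YB" using targets(2)[OF that] by blast
    show "conn (R j) (\<phi>B t)"
      by (rule R_mono[OF B(4)[OF t], of y]) (use B(1)[OF t] notS in blast)
    show "y \<in> \<phi>B t" by (rule B(2)[OF t])
  qed (rule targets(5)[OF that])
  have conn_C: "conn (R j) (PC j)" if "j \<in> I" for j
    unfolding PC_def
  proof (rule conn_UN[where r = z])
    fix t assume "t \<in> \<gamma> j"
    then have t: "t \<in> YC" using targets(3)[OF that] by blast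
    show "conn (R j) (\<phi>C t)"
      by (rule R_mono[OF C(4)[OF t], of z]) (use C(1)[OF t] notS in blast)
    show "z \<in> \<phi>C t" by (rule C(2)[OF t])
  qed (rule targets(6)[OF that])
  have aI: "a \<in> I" and bI: "b \<in> I"
    by (auto simp: I_def)
  have edge: "(v, f v) \<in> E" "(f v, v) \<in> E" if "v \<in> V b \<or> v \<in> V c" for v
    using that f_edge f_edge' J by blast+
  have inS: "v = x" if "v \<in> ?S" "v \<in> V a" for v using that notS by blast
  have inS': "v = y" if "v \<in> ?S" "v \<in> V b" for v using that notS by blast
  have inS'': "v = z" if "v \<in> ?S" "v \<in> V c" for v using that notS by blast
  have conn_W: "conn (R j) (W j)" if "j \<in> I" for j
  proof (rule I_cases[OF that])
    have "(f p, p) \<in> R a" "(s1, f s1) \<in> R a"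
      using edge p(1) s(1) inS[OF _ p(2)] inS'[OF _ p(1)] inS'[OF _ s(1)] inS''[OF _ s(2)]
      unfolding R_def F_def by auto
    moreover have "f p \<in> PA a" "p \<in> PB a" "s1 \<in> PB a" "f s1 \<in> PC a"
      using PV[OF aI] \<alpha>a by auto
    moreover have "W a = (PA a \<union> PB a) \<union> PC a"
      using \<alpha>a by (simp add: W_def)
    ultimately show "conn (R a) (W a)"
      using conn_edge_Un[OF conn_edge_Un[OF conn_A[OF aI] conn_B[OF aI] symR] conn_C[OF aI] symR]
      by (metis UnCI)
  next
    have "(f q, q) \<in> R b" "(f s2, s2) \<in> R b"
      using edge q(1) s(3,5) inS[OF _ q(2)] inS''[OF _ q(1)] inS'[OF _ s(3)] J(4)
      unfolding R_def F_def by auto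
    moreover have "f q \<in> PA b" "q \<in> PC b" "f s2 \<in> PC b" "s2 \<in> PB b"
      using PV[OF bI] \<alpha>b by auto
    moreover have "W b = (PA b \<union> PC b) \<union> PB b"
      using \<alpha>b by (auto simp add: W_def)
    ultimately show "conn (R b) (W b)"
      using conn_edge_Un[OF conn_edge_Un[OF conn_A[OF bI] conn_C[OF bI] symR] conn_B[OF bI] symR]
      by (metis UnCI)
  next
    fix j assume j: "j \<in> J'"
    then have jI: "j \<in> I" and jJ: "j \<in> J" using J' by (auto simp: I_def)
    have "V j \<inter> ?S = {}"
      using V_disjoint[OF jJ] j J' J x y z by blast
    then have hub: "conn (R j) (V j)" and out: "f (eA j) \<notin> ?S" "f (eB j) \<notin> ?S" "f (eC j) \<notin> ?S"
      using R_mono[of "V j" x j] k_connected_imp_conn[OF V_connected[OF jJ]] V_nonempty[OF jJ] k_ge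
        eA'(2)[OF j] eB'(2)[OF j] eC'(2)[OF j] by auto
    have "(eA j, f (eA j)) \<in> R j" "(f (eB j), eB j) \<in> R j" "(f (eC j), eC j) \<in> R j"
      using out f_edge[OF J(1) eA'(1)[OF j]] edge eB'(1)[OF j] eC'(1)[OF j] unfolding R_def by auto
    moreover have "eA j \<in> PA j" "eB j \<in> PB j" "eC j \<in> PC j"
      using PV[OF jI] \<alpha>J'[OF j] by auto
    moreover have "W j = ((PA j \<union> V j) \<union> PB j) \<union> PC j"
      using \<alpha>J'[OF j] by (auto simp: W_def)
    ultimately show "conn (R j) (W j)"
      using conn_edge_Un[OF conn_edge_Un[OF conn_edge_Un[OF conn_A[OF jI] hub symR] conn_B[OF jI] symR]
          conn_C[OF jI] symR] eA'(2)[OF j] eB'(2)[OF j] eC'(2)[OF j]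
      by (metis UnCI)
  qed
  have eA_inj: "eA i \<noteq> eA j" "eB i \<noteq> eB j" "eC i \<noteq> eC j" if "i \<in> J'" "j \<in> J'" "i \<noteq> j" for i j
    using V_unique[of i j] eA'(2) eB'(2) eC'(2) that J' by (metis subsetD)+
  \<comment> \<open>Applying \<open>f\<close> tells these exits apart: those towards hub
    \<open>j\<close> go into \<open>V j\<close>, the others into one of the three parts with
    terminals.\<close>
  have eJ': "eA j \<noteq> f p" "eA j \<noteq> f q" "eB j \<noteq> p" "eB j \<noteq> s1" "eB j \<noteq> s2"
    "eC j \<noteq> q" "eC j \<noteq> f s1" "eC j \<noteq> f s2" if "j \<in> J'" for j
  proof -
    have jJ: "j \<in> J" "j \<noteq> a" "j \<noteq> b" "j \<noteq> c" using that J' by auto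
    have *: "v \<notin> V j" if "v \<in> V a \<or> v \<in> V b \<or> v \<in> V c" for v
      using that V_unique jJ J by blast
    show "eA j \<noteq> f p" "eA j \<noteq> f q" "eB j \<noteq> p" "eB j \<noteq> s1" "eB j \<noteq> s2"
      "eC j \<noteq> q" "eC j \<noteq> f s1" "eC j \<noteq> f s2"
      using eA'(2)[OF that] eB'(2)[OF that] eC'(2)[OF that] ff * p q s by metis+
  qed
  have pq: "f p \<noteq> f q" "p \<noteq> s2" "s1 \<noteq> s2" "q \<noteq> f s1" "f s1 \<noteq> f s2"
    using V_unique J p q s s2(2) ff by metis+
  have disj_targets: "\<alpha> i \<inter> \<alpha> j = {} \<and> \<beta> i \<inter> \<beta> j = {} \<and> \<gamma> i \<inter> \<gamma> j = {} \<and> \<delta> i \<inter> \<delta> j = {}"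
    if "i \<in> I" "j \<in> I" "i \<noteq> j" for i j
  proof -
    have *: "i = a \<or> i = b \<or> i \<in> J'" "j = a \<or> j = b \<or> j \<in> J'"
      using that unfolding I_def by auto
    have "\<delta> i \<inter> \<delta> j = {}"
      using that(3) J' V_disjoint[of i j] by (auto simp: \<delta>_def)
    moreover have "\<alpha> i \<inter> \<alpha> j = {} \<and> \<beta> i \<inter> \<beta> j = {} \<and> \<gamma> i \<inter> \<gamma> j = {}"
      using * that(3) \<alpha>a \<alpha>b \<alpha>J'[of i] \<alpha>J'[of j] eJ'[of i] eJ'[of j] eA_inj[of i j] pq
      by (elim disjE) auto
    ultimately show ?thesis by blast
  qed
  show ?thesis
  proof (rule packingI[OF sym_E I, where W = W and F = F])
    fix j assume j: "j \<in> I"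
    have "\<delta> j \<subseteq> \<Union>(V ` J)"
      using J'(1) by (auto simp: \<delta>_def)
    moreover have "V a \<union> V b \<union> V c \<subseteq> \<Union>(V ` J)"
      using J by blast
    ultimately have "W j \<subseteq> \<Union>(V ` J)"
      using PV(1-3)[OF j] unfolding W_def by blast
    moreover have "?S \<subseteq> W j"
      using PV(4-6)[OF j] unfolding W_def by blast
    ultimately show "?S \<subseteq> W j \<and> W j \<subseteq> \<Union>(V ` J) \<and> conn ((E - ?S \<times> ?S) \<union> F j) (W j)"
      using conn_W[OF j] unfolding R_def by blast
    show "F j \<subseteq> E \<inter> ?S \<times> ?S \<and> sym (F j)"
      using symF[of j] unfolding F_def by auto
  next
    fix i j assume ij: "i \<in> I" "j \<in> I" "i \<noteq> j"
    have "PA i \<inter> PA j = {x}"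
    proof
      show "PA i \<inter> PA j \<subseteq> {x}"
      proof
        fix v assume "v \<in> PA i \<inter> PA j"
        then obtain t t' where t: "t \<in> \<alpha> i" "t' \<in> \<alpha> j" "v \<in> \<phi>A t \<inter> \<phi>A t'"
          unfolding PA_def by blast
        then show "v \<in> {x}"
          using A(5)[of t t'] disj_targets[OF ij] targets(1)[OF ij(1)] targets(1)[OF ij(2)] by blast
      qed
    qed (use PV[OF ij(1)] PV[OF ij(2)] in blast)
    moreover have "PB i \<inter> PB j = {y}"
    proof
      show "PB i \<inter> PB j \<subseteq> {y}"
      proof
        fix v assume "v \<in> PB i \<inter> PB j"
        then obtain t t' where t: "t \<in> \<beta> i" "t' \<in> \<beta> j" "v \<in> \<phi>B t \<inter> \<phi>B t'"
          unfolding PB_def by blast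
        then show "v \<in> {y}"
          using B(5)[of t t'] disj_targets[OF ij] targets(2)[OF ij(1)] targets(2)[OF ij(2)] by blast
      qed
    qed (use PV[OF ij(1)] PV[OF ij(2)] in blast)
    moreover have "PC i \<inter> PC j = {z}"
    proof
      show "PC i \<inter> PC j \<subseteq> {z}"
      proof
        fix v assume "v \<in> PC i \<inter> PC j"
        then obtain t t' where t: "t \<in> \<gamma> i" "t' \<in> \<gamma> j" "v \<in> \<phi>C t \<inter> \<phi>C t'"
          unfolding PC_def by blast
        then show "v \<in> {z}"
          using C(5)[of t t'] disj_targets[OF ij] targets(3)[OF ij(1)] targets(3)[OF ij(2)] by blast
      qed
    qed (use PV[OF ij(1)] PV[OF ij(2)] in blast)
    moreover have "\<delta> i \<inter> \<delta> j = {}"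
      using disj_targets[OF ij] by blast
    moreover have "\<delta> l \<inter> V m = {}" if "m = a \<or> m = b \<or> m = c" for l m
    proof (cases "l \<in> J'")
      case True
      then have "l \<in> J" "m \<in> J" "l \<noteq> m"
        using that J J' by auto
      then show ?thesis
        using V_disjoint by (simp add: \<delta>_def)
    qed (simp add: \<delta>_def)
    then have "\<delta> i \<inter> V a = {}" "\<delta> i \<inter> V b = {}" "\<delta> i \<inter> V c = {}"
      "\<delta> j \<inter> V a = {}" "\<delta> j \<inter> V b = {}" "\<delta> j \<inter> V c = {}"
      by simp_all
    moreover have "V a \<inter> V b = {}" "V a \<inter> V c = {}" "V b \<inter> V c = {}"
      using V_disjoint J by simp_all
    ultimately have parts: "PA i \<inter> PA j = {x}" "PB i \<inter> PB j = {y}" "PC i \<inter> PC j = {z}" "\<delta> i \<inter> \<delta> j = {}"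
      "V a \<inter> V b = {}" "(V a \<union> V b) \<inter> V c = {}" "(V a \<union> V b \<union> V c) \<inter> (\<delta> i \<union> \<delta> j) = {}"
      by (simp_all only: Int_Un_distrib Int_Un_distrib2 Un_empty Int_commute)
    \<comment> \<open>Splitting off disjoint parts one at a time reduces the intersection to
      intersections within each part.\<close>
    have Un_Int_Un: "(X1 \<union> Y1) \<inter> (X2 \<union> Y2) = (X1 \<inter> X2) \<union> (Y1 \<inter> Y2)"
      if "X \<inter> Y = {}" "X1 \<subseteq> X" "Y1 \<subseteq> Y" "X2 \<subseteq> X" "Y2 \<subseteq> Y" for X X1 X2 Y Y1 Y2 :: "'a set"
      using that by blast
    note P = PV(1-3)[OF ij(1)] PV(1-3)[OF ij(2)]
    have "W i \<inter> W j = (PA i \<union> PB i \<union> PC i) \<inter> (PA j \<union> PB j \<union> PC j) \<union> (\<delta> i \<inter> \<delta> j)"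
      unfolding W_def by (rule Un_Int_Un[OF parts(7)]) (use P in auto)
    also have "(PA i \<union> PB i \<union> PC i) \<inter> (PA j \<union> PB j \<union> PC j)
        = (PA i \<union> PB i) \<inter> (PA j \<union> PB j) \<union> (PC i \<inter> PC j)"
      by (rule Un_Int_Un[OF parts(6)]) (use P in auto)
    also have "(PA i \<union> PB i) \<inter> (PA j \<union> PB j) = (PA i \<inter> PA j) \<union> (PB i \<inter> PB j)"
      by (rule Un_Int_Un[OF parts(5)]) (use P in auto)
    finally have "W i \<inter> W j = ?S"
      using parts(1-4) by auto
    moreover have "F i \<inter> F j = {}"
      using ij(3) distinct unfolding F_def by auto
    ultimately show "W i \<inter> W j = ?S \<and> F i \<inter> F j = {}" ..
  qed
qed

text \<open>Only the case of three terminals in one part uses a packing of that part; the other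
  cases rest on connectivity alone.\<close>

theorem packing_union:
  assumes S: "S \<subseteq> \<Union>(V ` J)" "card S = 3"
    and part: "\<And>i. i \<in> J \<Longrightarrow> S \<subseteq> V i \<Longrightarrow> packing E (V i) S (k - 1)"
  shows "packing E (\<Union>(V ` J)) S k"
proof -
  obtain x y z where xyz: "S = {x, y, z}" "x \<noteq> y" "x \<noteq> z" "y \<noteq> z"
    using S(2) by (auto simp: card_3_iff)
  have "x \<in> \<Union>(V ` J)" "y \<in> \<Union>(V ` J)" "z \<in> \<Union>(V ` J)"
    using S(1) xyz(1) by auto
  then obtain a b c where abc: "a \<in> J" "b \<in> J" "c \<in> J" "x \<in> V a" "y \<in> V b" "z \<in> V c"
    by blast
  have other: "v \<notin> V i" if "i \<in> J" "j \<in> J" "i \<noteq> j" "v \<in> V j" for v i j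
    using that V_unique by blast
  consider "a = b" "b = c" | "a = b" "b \<noteq> c" | "a = c" "a \<noteq> b" | "b = c" "a \<noteq> b"
    | "a \<noteq> b" "a \<noteq> c" "b \<noteq> c" by blast
  then show ?thesis
  proof cases
    case 1
    have "packing E (\<Union>(V ` J)) S (Suc (k - 1))"
    proof (rule packing_same_part[OF sym_E])
      have rest: "\<Union>(V ` J) - V a = \<Union>(V ` (J - {a}))"
        using V_disjoint abc(1) by blast
      show "conn E (\<Union>(V ` J) - V a)"
        unfolding rest by (rule union_minus_one_conn[OF abc(1)])
      show "V a \<subseteq> \<Union>(V ` J)"
        using abc by blast
      show "S \<subseteq> V a"
        using abc 1 xyz by blast
      then show "packing E (V a) S (k - 1)"
        by (rule part[OF abc(1)])
      fix s assume "s \<in> S"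
      then have "s \<in> V a" using \<open>S \<subseteq> V a\<close> by blast
      then show "\<exists>b\<in>\<Union>(V ` J) - V a. (s, b) \<in> E"
        unfolding rest using f_leaves[OF abc(1), of s] f_edge[OF abc(1), of s] by blast
    qed
    then show ?thesis
      using k_ge by simp
  next
    case 2
    then show ?thesis
      using packing_two_parts[of a x y z] abc other[of a c z] xyz by auto
  next
    case 3
    then show ?thesis
      using packing_two_parts[of a x z y] abc other[of a b y] xyz by (auto simp: insert_commute)
  next
    case 4
    then show ?thesis
      using packing_two_parts[of b y z x] abc other[of b a x] xyz by (auto simp: insert_commute)
  next
    case 5
    then show ?thesis
      unfolding xyz(1) using abc by (intro packing_three_parts)
  qed
qed

end

section \<open>Prisms\<close>

definition complete_on :: "'a rel \<Rightarrow> 'a set \<Rightarrow> bool" where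
  "complete_on E V \<longleftrightarrow> (\<forall>u\<in>V. \<forall>v\<in>V. u \<noteq> v \<longrightarrow> (u, v) \<in> E)"

text \<open>Two proper sides would contain distinct non-adjacent vertices, so the condition is
  vacuous and holds for every \<open>k\<close>.\<close>

lemma complete_on_k_connected: "complete_on E V \<Longrightarrow> k_connected E V k"
  unfolding k_connected_def
proof (intro allI impI)
  fix P Q assume V: "complete_on E V" and PQ: "separation E V P Q" "P - Q \<noteq> {}" "Q - P \<noteq> {}"
  then obtain p q where pq: "p \<in> P - Q" "q \<in> Q - P"
    by blast
  then have "p \<in> V" "q \<in> V" "p \<noteq> q"
    using PQ(1) unfolding separation_def by auto
  then have "(p, q) \<in> E"
    using V unfolding complete_on_def by blast
  then show "k \<le> card (P \<inter> Q)"
    using PQ(1) pq unfolding separation_def by blast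
qed

lemma complete_on_side:
  assumes "complete_on E A" "A \<subseteq> V" "separation E V P Q"
  shows "A \<subseteq> P \<or> A \<subseteq> Q"
proof (rule ccontr)
  assume "\<not> ?thesis"
  then obtain a b where ab: "a \<in> A" "a \<notin> P" "b \<in> A" "b \<notin> Q" by blast
  then have "a \<in> Q - P" "b \<in> P - Q"
    using assms(2,3) unfolding separation_def by auto
  then show False
    using assms(1,3) ab unfolding separation_def complete_on_def by (metis DiffD2 DiffE)
qed

text \<open>The same count as in \<open>cut_edges\<close>: each matching edge has an end in the
  separator.\<close>

lemma matching_le_separator:
  assumes "inj_on f A" "\<And>a. a \<in> A \<Longrightarrow> f a \<in> B \<and> (a, f a) \<in> E" "A \<inter> B = {}"
    and "A \<subseteq> P" "B \<subseteq> Q" "separation E V P Q" "finite V"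
  shows "card A \<le> card (P \<inter> Q)"
proof -
  define g where "g a = (if a \<in> Q then a else f a)" for a
  have "inj_on g A"
  proof (rule inj_onI)
    fix a b assume ab: "a \<in> A" "b \<in> A" "g a = g b"
    have "f a \<notin> A" "f b \<notin> A"
      using assms(2,3) ab by blast+
    then show "a = b"
      using ab inj_onD[OF assms(1) _ ab(1,2)] unfolding g_def by (metis (full_types))
  qed
  moreover have "g ` A \<subseteq> P \<inter> Q"
  proof
    fix w assume "w \<in> g ` A"
    then obtain a where a: "a \<in> A" "w = g a" by blast
    have "a \<in> P" "f a \<in> Q" "(a, f a) \<in> E"
      using assms(2)[OF a(1)] assms(4,5) a(1) by auto
    then show "w \<in> P \<inter> Q"
      using assms(6) a(2) unfolding separation_def g_def by auto
  qed
  moreover have "finite (P \<inter> Q)"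
    using assms(6,7) unfolding separation_def by (metis finite_Int finite_Un)
  ultimately show ?thesis
    by (rule card_inj_on_le)
qed

text \<open>Dimension 3 has no generator of the form \<open>(12)(3i)\<close>. It is split by the
  3-cycles instead, into two triangles matched by \<open>(12)\<close>.\<close>

locale prism =
  fixes E :: "'a rel" and A B :: "'a set" and f :: "'a \<Rightarrow> 'a"
  assumes sym_E: "sym E"
    and card_A: "card A = 3" and card_B: "card B = 3" and disj: "A \<inter> B = {}"
    and complete_A: "complete_on E A" and complete_B: "complete_on E B"
    and f_A: "\<And>a. a \<in> A \<Longrightarrow> f a \<in> B" and f_B: "\<And>b. b \<in> B \<Longrightarrow> f b \<in> A"
    and f_f: "\<And>a. a \<in> A \<union> B \<Longrightarrow> f (f a) = a"
    and f_edge: "\<And>a. a \<in> A \<union> B \<Longrightarrow> (a, f a) \<in> E"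
begin

lemma finite: "finite A" "finite B"
  using card_A card_B by (auto intro: card_ge_0_finite)

lemma inj: "inj_on f A" "inj_on f B"
  using f_f by (metis UnI1 inj_onI) (metis f_f UnI2 inj_onI)

text \<open>Lets each lemma about one triangle be reused for the other.\<close>

lemma swap: "prism E B A f"
proof
  show "B \<inter> A = {}" using disj by blast
  show "f (f a) = a" "(a, f a) \<in> E" if "a \<in> B \<union> A" for a
    using that f_f[of a] f_edge[of a] by auto
qed (fact sym_E card_A card_B complete_A complete_B f_A f_B)+

text \<open>A triangle is never split, so the two lie on opposite sides and the three matching edges
  give three separating vertices.\<close>

lemma connected: "k_connected E (A \<union> B) 3"
  unfolding k_connected_def
proof (intro allI impI)
  fix P Q assume PQ: "separation E (A \<union> B) P Q" "P - Q \<noteq> {}" "Q - P \<noteq> {}"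
  have fin: "finite (A \<union> B)" using finite by simp
  have "A \<subseteq> P \<or> A \<subseteq> Q" "B \<subseteq> P \<or> B \<subseteq> Q"
    by (rule complete_on_side[OF complete_A _ PQ(1)], blast)
      (rule complete_on_side[OF complete_B _ PQ(1)], blast)
  moreover have "\<not> (A \<subseteq> P \<and> B \<subseteq> P)" "\<not> (A \<subseteq> Q \<and> B \<subseteq> Q)"
    using PQ unfolding separation_def by blast+
  ultimately consider "A \<subseteq> P" "B \<subseteq> Q" | "B \<subseteq> P" "A \<subseteq> Q" by blast
  then show "3 \<le> card (P \<inter> Q)"
  proof cases
    case 1
    have "card A \<le> card (P \<inter> Q)"
      using matching_le_separator[OF inj(1) _ disj 1 PQ(1) fin] f_A f_edge by blast
    then show ?thesis using card_A by simp
  next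
    case 2
    have "card B \<le> card (P \<inter> Q)"
      using matching_le_separator[OF inj(2) _ _ 2 PQ(1) fin] f_B f_edge disj by blast
    then show ?thesis using card_B by simp
  qed
qed

lemma conn_B: "conn E B"
  using complete_on_k_connected[OF complete_B, of 1] card_B
  by (intro k_connected_imp_conn[of _ _ 1]) auto

text \<open>2 is the largest \<open>k\<close> below the size of a triangle; the connectivity
  conditions hold since triangles are complete.\<close>

lemma packing_two_one_side:
  assumes "x \<in> A" "y \<in> A" "x \<noteq> y" "z \<in> B"
  shows "packing E (A \<union> B) {x, y, z} 2"
proof (rule packing_two_one[where A = A and f = f])
  have B: "A \<union> B - A = B"
    using disj by blast
  show "k_connected E (A \<union> B - A) 2" "z \<in> A \<union> B - A"
    unfolding B using complete_on_k_connected[OF complete_B] assms(4) by auto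
  show "f a \<in> A \<union> B - A \<and> (a, f a) \<in> E" if "a \<in> A" for a
    unfolding B using f_A[OF that] f_edge[of a] that by blast
qed (use sym_E complete_on_k_connected[OF complete_A] card_A assms inj finite in auto)

text \<open>One tree inside the triangle and one through the opposite triangle.\<close>

lemma packing_side:
  assumes "S \<subseteq> A"
  shows "packing E (A \<union> B) S 2"
proof -
  have B: "A \<union> B - A = B"
    using disj by blast
  have "packing E A S 1"
    using prism.conn_B[OF swap] assms sym_E by (intro packing_one)
  then have "packing E (A \<union> B) S (Suc 1)"
    using assms conn_B f_A f_edge by (intro packing_same_part[of E A]) (auto simp: B sym_E)
  then show ?thesis
    by (simp add: numeral_2_eq_2)
qed

lemma packing:
  assumes "S \<subseteq> A \<union> B" "card S = 3"
  shows "packing E (A \<union> B) S 2"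
proof -
  obtain x y z where xyz: "S = {x, y, z}" "x \<noteq> y" "x \<noteq> z" "y \<noteq> z"
    using assms(2) by (auto simp: card_3_iff)
  note 1 = packing_two_one_side
  note 2 = prism.packing_two_one_side[OF swap, unfolded Un_commute[of B A]]
  have xA: "x \<in> A \<or> x \<in> B" "y \<in> A \<or> y \<in> B" "z \<in> A \<or> z \<in> B"
    using assms(1) xyz by auto
  consider "S \<subseteq> A" | "S \<subseteq> B" | "x \<in> A" "y \<in> A" "z \<in> B" | "x \<in> A" "z \<in> A" "y \<in> B"
    | "y \<in> A" "z \<in> A" "x \<in> B" | "x \<in> B" "y \<in> B" "z \<in> A" | "x \<in> B" "z \<in> B" "y \<in> A"
    | "y \<in> B" "z \<in> B" "x \<in> A"
    using xA xyz(1) by blast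
  then show ?thesis
  proof cases
    case 1
    then show ?thesis by (rule packing_side)
  next
    case 2
    then show ?thesis
      using prism.packing_side[OF swap, of S] by (simp add: Un_commute)
  next
    case 3
    then show ?thesis using 1[of x y z] xyz by simp
  next
    case 4
    then show ?thesis using 1[of x z y] xyz by (simp add: insert_commute)
  next
    case 5
    then show ?thesis using 1[of y z x] xyz by (simp add: insert_commute)
  next
    case 6
    then show ?thesis using 2[of x y z] xyz by simp
  next
    case 7
    then show ?thesis using 2[of x z y] xyz by (simp add: insert_commute)
  next
    case 8
    then show ?thesis using 2[of y z x] xyz by (simp add: insert_commute)
  qed
qed

end


section \<open>Cosets of symmetric groups\<close>

text \<open>Not restricted to permutations of \<open>{1..n}\<close>, so that a single relation
  serves all cosets and all dimensions of the induction. A generator \<open>(12)(3i)\<close> with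
  \<open>i > m\<close> moves position \<open>i\<close> and thus leaves a coset of dimension
  \<open>m\<close>.\<close>

definition godan_rel :: "nat \<Rightarrow> (nat \<Rightarrow> nat) rel" where
  "godan_rel n = {(u, u \<circ> s) | u s. s \<in> godan_gens n}"

lemma godan_relI: "s \<in> godan_gens n \<Longrightarrow> (u, u \<circ> s) \<in> godan_rel n"
  unfolding godan_rel_def by blast

lemma sym_godan_rel: "sym (godan_rel n)"
proof (rule symI)
  fix u v assume "(u, v) \<in> godan_rel n"
  then obtain s where s: "s \<in> godan_gens n" "v = u \<circ> s"
    unfolding godan_rel_def by blast
  then obtain t where "t \<in> godan_gens n" "s \<circ> t = id"
    using godan_gens_inverse_closed by blast
  moreover from this have "u = v \<circ> t"
    using s(2) by (metis comp_assoc comp_id)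
  ultimately show "(v, u) \<in> godan_rel n"
    using godan_relI by metis
qed

text \<open>For bijective \<open>\<tau>\<close> this is the coset of the symmetric group on \<open>{1..m}\<close> containing \<open>\<tau>\<close>.\<close>

definition coset :: "nat \<Rightarrow> (nat \<Rightarrow> nat) \<Rightarrow> (nat \<Rightarrow> nat) set" where
  "coset m \<tau> = {u. bij u \<and> (\<forall>i. i \<notin> {1..m} \<longrightarrow> u i = \<tau> i)}"

lemma coset_bij: "u \<in> coset m \<tau> \<Longrightarrow> bij u"
  by (simp add: coset_def)

lemma coset_comp: "u \<in> coset m \<tau> \<Longrightarrow> p permutes {1..m} \<Longrightarrow> u \<circ> p \<in> coset m \<tau>"
  unfolding coset_def by (auto simp: permutes_not_in intro: bij_comp permutes_bij)

lemma coset_eq_image: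
  assumes "bij \<tau>"
  shows "coset m \<tau> = (\<lambda>p. \<tau> \<circ> p) ` {p. p permutes {1..m}}"
proof
  show "coset m \<tau> \<subseteq> (\<lambda>p. \<tau> \<circ> p) ` {p. p permutes {1..m}}"
  proof
    fix u assume u: "u \<in> coset m \<tau>"
    have "bij (inv_into UNIV \<tau> \<circ> u)"
      using assms u by (intro bij_comp bij_imp_bij_inv) (auto simp: coset_def)
    moreover have "(inv_into UNIV \<tau> \<circ> u) i = i" if "i \<notin> {1..m}" for i
      using u that assms by (auto simp: coset_def bij_is_inj)
    ultimately have "inv_into UNIV \<tau> \<circ> u permutes {1..m}"
      unfolding permutes_def bij_iff by blast
    moreover have "u = \<tau> \<circ> (inv_into UNIV \<tau> \<circ> u)"
      using assms by (simp add: fun_eq_iff bij_is_surj surj_f_inv_f)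
    ultimately show "u \<in> (\<lambda>p. \<tau> \<circ> p) ` {p. p permutes {1..m}}"
      by blast
  qed
  show "(\<lambda>p. \<tau> \<circ> p) ` {p. p permutes {1..m}} \<subseteq> coset m \<tau>"
    using assms coset_comp[of \<tau> m \<tau>] by (auto simp: coset_def)
qed

lemma finite_coset: "bij \<tau> \<Longrightarrow> finite (coset m \<tau>)"
  by (simp add: coset_eq_image finite_permutations)

lemma card_coset: "bij \<tau> \<Longrightarrow> card (coset m \<tau>) = fact m"
proof -
  assume \<tau>: "bij \<tau>"
  have "inj_on (\<lambda>p. \<tau> \<circ> p) {p. p permutes {1..m}}"
    by (rule inj_onI) (metis \<tau> bij_is_inj fun.inj_map injD)
  then show ?thesis
    using \<tau> by (simp add: coset_eq_image card_image card_permutations)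
qed

lemma coset_id: "coset n id = {p. p permutes {1..n}}"
  by (simp add: coset_eq_image image_def)

lemma coset_value:
  assumes "u \<in> coset m \<tau>" "bij \<tau>" "i \<in> {1..m}"
  shows "u i \<in> \<tau> ` {1..m}"
proof -
  obtain p where "p permutes {1..m}" "u = \<tau> \<circ> p"
    using assms(1,2) by (auto simp: coset_eq_image)
  then show ?thesis
    using assms(3) permutes_in_image by fastforce
qed

text \<open>The parts of a coset are cosets of one dimension less, based at any of their members;
  this is why the induction runs over all \<open>\<tau>\<close>.\<close>

lemma subcoset_eq:
  assumes "u \<in> coset (Suc k) \<tau>"
  shows "{v \<in> coset (Suc k) \<tau>. v (Suc k) = u (Suc k)} = coset k u"
proof -
  have "(\<forall>i. i \<notin> {1..k} \<longrightarrow> v i = u i) \<longleftrightarrow> (\<forall>i. i \<notin> {1..Suc k} \<longrightarrow> v i = u i) \<and> v (Suc k) = u (Suc k)" for v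
    by (auto simp: le_Suc_eq)
  moreover have "(\<forall>i. i \<notin> {1..Suc k} \<longrightarrow> v i = u i) \<longleftrightarrow> (\<forall>i. i \<notin> {1..Suc k} \<longrightarrow> v i = \<tau> i)" for v
    using assms by (auto simp: coset_def)
  ultimately show ?thesis
    unfolding coset_def by auto
qed

text \<open>The matching swaps positions \<open>3\<close> and \<open>Suc k\<close>, so it sends
  \<open>u\<close> to the part of \<open>u 3\<close>, which differs from \<open>u (Suc k)\<close>.
  Two exits between given parts differ by \<open>(12)\<close>, which affects neither
  position.\<close>

lemma godan_clusters:
  assumes k: "3 \<le> k" "Suc k \<le> n" and \<tau>: "bij \<tau>"
    and IH: "\<And>u. bij u \<Longrightarrow> k_connected (godan_rel n) (coset k u) k"
  shows "clusters (godan_rel n) (\<tau> ` {1..Suc k}) (\<lambda>c. {u \<in> coset (Suc k) \<tau>. u (Suc k) = c})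
    (\<lambda>u. u \<circ> (transpose 1 2 \<circ> transpose 3 (Suc k))) k"
proof
  let ?m = "Suc k"
  let ?V = "\<lambda>c. {u \<in> coset ?m \<tau>. u ?m = c}"
  let ?s = "transpose 1 2 \<circ> transpose 3 ?m :: nat \<Rightarrow> nat"
  have \<tau>c: "\<tau> \<in> coset ?m \<tau>"
    using \<tau> by (simp add: coset_def)
  have s: "?s permutes {1..?m}" "?s ?m = 3" "?s 3 = ?m" "?s \<circ> ?s = id"
    using k(1) by (auto intro!: permutes_compose permutes_swap_id simp: fun_eq_iff transpose_def)
  have part: "\<exists>u. bij u \<and> ?V c = coset k u" if c: "c \<in> \<tau> ` {1..?m}" for c
  proof -
    obtain i where i: "i \<in> {1..?m}" "c = \<tau> i"
      using c by blast
    \<comment> \<open>A member of the coset with the value \<open>c\<close> at position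
      \<open>?m\<close>.\<close>
    have "\<tau> \<circ> transpose i ?m \<in> coset ?m \<tau>"
      using \<tau>c i by (intro coset_comp permutes_swap_id) auto
    from subcoset_eq[OF this] coset_bij[OF this] show ?thesis
      using i by (intro exI[of _ "\<tau> \<circ> transpose i ?m"]) simp
  qed
  show "sym (godan_rel n)" by (rule sym_godan_rel)
  show "finite (\<tau> ` {1..?m})" by simp
  show "card (\<tau> ` {1..?m}) = Suc k"
    using \<tau> by (subst card_image) (auto simp: bij_def inj_on_def)
  show "3 \<le> k" by fact
  fix c assume c: "c \<in> \<tau> ` {1..?m}"
  then obtain w where w: "bij w" "?V c = coset k w"
    using part by blast
  show "finite (?V c)"
    using w finite_coset by simp
  show "k_connected (godan_rel n) (?V c) k"
    using w IH by simp
  have "k < (fact k :: nat)"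
  proof -
    obtain j where j: "k = Suc j" "2 \<le> j"
      using k(1) by (cases k) auto
    have "Suc j * 2 \<le> Suc j * fact j"
      using j(2) fact_ge_self[of j] by (intro mult_le_mono2) linarith
    then show ?thesis
      using j(1) by simp
  qed
  then show "k < card (?V c)"
    using w card_coset by simp
  fix v assume v: "v \<in> ?V c"
  have vs: "v \<circ> ?s \<in> coset ?m \<tau>"
    using v s(1) by (intro coset_comp) auto
  have "v 3 \<noteq> v ?m"
    using v k(1) coset_bij[of v] by (auto simp: bij_def inj_eq)
  moreover have "v 3 \<in> \<tau> ` {1..?m}"
    using v \<tau> k(1) by (intro coset_value) auto
  ultimately show "\<exists>j\<in>\<tau> ` {1..?m} - {c}. v \<circ> ?s \<in> ?V j"
    using vs v s(2) by (intro bexI[of _ "v 3"]) auto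
  show "v \<circ> ?s \<circ> ?s = v"
    using s(4) by (simp only: comp_assoc comp_id)
  have "?s \<in> godan_gens n"
    using k unfolding godan_gens_def by auto
  then show "(v, v \<circ> ?s) \<in> godan_rel n"
    by (rule godan_relI)
next
  let ?m = "Suc k"
  let ?V = "\<lambda>c. {u \<in> coset ?m \<tau>. u ?m = c}"
  let ?s = "transpose 1 2 \<circ> transpose 3 ?m :: nat \<Rightarrow> nat"
  fix c d assume cd: "c \<in> \<tau> ` {1..?m}" "d \<in> \<tau> ` {1..?m}" "c \<noteq> d"
  show "?V c \<inter> ?V d = {}"
    using cd(3) by auto
  obtain a b where ab: "a \<in> {1..?m}" "b \<in> {1..?m}" "c = \<tau> a" "d = \<tau> b" "a \<noteq> b"
    using cd by blast
  \<comment> \<open>\<open>e\<close> is the position that holds \<open>d\<close> once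
    \<open>c\<close> has been moved to position \<open>?m\<close>; swapping it with \<open>3\<close>
    produces an exit from \<open>c\<close> to \<open>d\<close>.\<close>
  define e where "e = transpose a ?m b"
  have e: "e \<in> {1..?m}" "e \<noteq> ?m"
    using ab by (auto simp: e_def transpose_def)
  define u where "u = \<tau> \<circ> (transpose a ?m \<circ> transpose 3 e)"
  have "\<tau> \<in> coset ?m \<tau>"
    using \<tau> by (simp add: coset_def)
  then have u: "u \<in> coset ?m \<tau>"
    unfolding u_def using ab e k(1)
    by (intro coset_comp permutes_compose permutes_swap_id) auto
  have um: "u ?m = c" "u 3 = d"
    using ab e k(1) by (auto simp: u_def e_def transpose_def)
  \<comment> \<open>Exchanging the first two values gives the second exit.\<close>
  let ?u = "u \<circ> transpose 1 2"
  have u': "?u \<in> coset ?m \<tau>"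
    using u k(1) by (intro coset_comp permutes_swap_id) auto
  have "u 1 \<noteq> u 2"
    using coset_bij[OF u] by (simp add: bij_def inj_eq)
  then have ne: "u \<noteq> ?u"
    by (metis comp_apply transpose_apply_first)
  have perm_s: "?s permutes {1..?m}"
    using k(1) by (auto intro!: permutes_compose permutes_swap_id)
  have sub: "{u, ?u} \<subseteq> {v \<in> ?V c. v \<circ> ?s \<in> ?V d}"
    using u u' um k(1) coset_comp[OF u perm_s] coset_comp[OF u' perm_s]
    by (auto simp: transpose_def)
  have "finite {v \<in> ?V c. v \<circ> ?s \<in> ?V d}"
    using finite_coset[OF \<tau>] by simp
  from card_mono[OF this sub] show "2 \<le> card {v \<in> ?V c. v \<circ> ?s \<in> ?V d}"
    using ne by simp
qed

section \<open>The cosets of dimension three\<close>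

definition triangle :: "(nat \<Rightarrow> nat) \<Rightarrow> (nat \<Rightarrow> nat) set" where
  "triangle u = {u, u \<circ> cycle_of_list [1, 2, 3], u \<circ> cycle_of_list [1, 3, 2]}"

text \<open>The last two identities say that conjugation by \<open>(12)\<close> inverts the
  3-cycles; hence right multiplication by \<open>(12)\<close> maps triangles to triangles.\<close>

lemma cycle_compositions:
  "cycle_of_list [1, 2, 3] \<circ> cycle_of_list [1, 2, 3] = (cycle_of_list [1, 3, 2] :: nat \<Rightarrow> nat)"
  "cycle_of_list [1, 3, 2] \<circ> cycle_of_list [1, 3, 2] = (cycle_of_list [1, 2, 3] :: nat \<Rightarrow> nat)"
  "cycle_of_list [1, 2, 3] \<circ> cycle_of_list [1, 3, 2] = (id :: nat \<Rightarrow> nat)"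
  "cycle_of_list [1, 3, 2] \<circ> cycle_of_list [1, 2, 3] = (id :: nat \<Rightarrow> nat)"
  "cycle_of_list [1, 2, 3] \<circ> transpose 1 2 = transpose 1 2 \<circ> (cycle_of_list [1, 3, 2] :: nat \<Rightarrow> nat)"
  "cycle_of_list [1, 3, 2] \<circ> transpose 1 2 = transpose 1 2 \<circ> (cycle_of_list [1, 2, 3] :: nat \<Rightarrow> nat)"
  by (auto simp: fun_eq_iff transpose_def)

lemma complete_on_triangle: "complete_on (godan_rel n) (triangle u)"
proof -
  let ?c = "cycle_of_list [1, 2, 3] :: nat \<Rightarrow> nat" and ?d = "cycle_of_list [1, 3, 2] :: nat \<Rightarrow> nat"
  have gens: "?c \<in> godan_gens n" "?d \<in> godan_gens n"
    by (simp_all only: godan_gens_def Un_iff insert_iff simp_thms)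
  have step: "(w, w \<circ> ?c) \<in> godan_rel n" "(w, w \<circ> ?d) \<in> godan_rel n" for w
    using gens by (auto intro: godan_relI simp del: cycle_of_list.simps)
  have bwd: "(w \<circ> ?c, w) \<in> godan_rel n" "(w \<circ> ?d, w) \<in> godan_rel n" for w
    using step sym_godan_rel by (auto dest: symD simp del: cycle_of_list.simps)
  have "(u \<circ> ?c, u \<circ> ?d) \<in> godan_rel n" "(u \<circ> ?d, u \<circ> ?c) \<in> godan_rel n"
    using step(1)[of "u \<circ> ?c"] step(2)[of "u \<circ> ?d"]
    by (simp_all only: comp_assoc cycle_compositions)
  then show ?thesis
    unfolding complete_on_def triangle_def using step bwd
    by (auto simp del: cycle_of_list.simps)
qed

lemma triangle_transpose:
  assumes "v \<in> triangle u"
  shows "v \<circ> transpose 1 2 \<in> triangle (u \<circ> transpose 1 2)"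
proof -
  have "u \<circ> cycle_of_list [1, 2, 3] \<circ> transpose 1 2 = u \<circ> transpose 1 2 \<circ> cycle_of_list [1, 3, 2]"
    "u \<circ> cycle_of_list [1, 3, 2] \<circ> transpose 1 2 = u \<circ> transpose 1 2 \<circ> cycle_of_list [1, 2, 3]"
    by (simp_all only: comp_assoc cycle_compositions)
  then show ?thesis
    using assms unfolding triangle_def by (auto simp del: cycle_of_list.simps)
qed

text \<open>Keeps the two triangles of a coset apart: no rotation of three distinct values is also a
  rotation of their arrangement with the first two exchanged.\<close>

lemma triangle_values:
  assumes "v \<in> triangle u"
  shows "(v 1, v 2, v 3) \<in> {(u 1, u 2, u 3), (u 2, u 3, u 1), (u 3, u 1, u 2)}"
  using assms unfolding triangle_def by (auto simp: transpose_def)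

lemma card_triangle:
  assumes "bij u"
  shows "card (triangle u) = 3"
proof -
  have u: "u 1 \<noteq> u 2" "u 1 \<noteq> u 3" "u 2 \<noteq> u 3"
    using inj_eq[OF bij_is_inj[OF assms]] by simp_all
  have "(u \<circ> cycle_of_list [1, 2, 3]) 1 = u 2" "(u \<circ> cycle_of_list [1, 3, 2]) 1 = u 3"
    by (simp_all add: transpose_def)
  then have "u \<noteq> u \<circ> cycle_of_list [1, 2, 3]" "u \<noteq> u \<circ> cycle_of_list [1, 3, 2]"
    "u \<circ> cycle_of_list [1, 2, 3] \<noteq> u \<circ> cycle_of_list [1, 3, 2]"
    using u by metis+
  then show ?thesis
    unfolding triangle_def by (simp del: cycle_of_list.simps)
qed

lemma triangle_subset_coset: "bij u \<Longrightarrow> triangle u \<subseteq> coset 3 u"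
proof -
  assume u: "bij u"
  have "cycle_of_list [1, 2, 3] permutes {1..3::nat}" "cycle_of_list [1, 3, 2] permutes {1..3::nat}"
    by (auto intro!: permutes_compose permutes_swap_id permutes_id)
  moreover have "u \<in> coset 3 u"
    using u by (simp add: coset_def)
  ultimately show ?thesis
    unfolding triangle_def by (auto intro: coset_comp simp del: cycle_of_list.simps)
qed

lemma coset_prism:
  assumes \<tau>: "bij \<tau>"
  shows "prism (godan_rel n) (triangle \<tau>) (triangle (\<tau> \<circ> transpose 1 2)) (\<lambda>u. u \<circ> transpose 1 2)"
proof
  have \<tau>': "bij (\<tau> \<circ> transpose 1 2)"
    using \<tau> by (intro bij_comp) auto
  show "card (triangle \<tau>) = 3" "card (triangle (\<tau> \<circ> transpose 1 2)) = 3"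
    using \<tau> \<tau>' by (simp_all add: card_triangle)
  have ne: "\<tau> 1 \<noteq> \<tau> 2" "\<tau> 1 \<noteq> \<tau> 3" "\<tau> 2 \<noteq> \<tau> 3"
    using inj_eq[OF bij_is_inj[OF \<tau>]] by simp_all
  have "False" if "v \<in> triangle \<tau>" "v \<in> triangle (\<tau> \<circ> transpose 1 2)" for v
    using triangle_values[OF that(1)] triangle_values[OF that(2)] ne by (auto simp: transpose_def)
  then show "triangle \<tau> \<inter> triangle (\<tau> \<circ> transpose 1 2) = {}"
    by blast
  show "a \<circ> transpose 1 2 \<in> triangle (\<tau> \<circ> transpose 1 2)" if "a \<in> triangle \<tau>" for a
    using that by (rule triangle_transpose)
  show "b \<circ> transpose 1 2 \<in> triangle \<tau>" if "b \<in> triangle (\<tau> \<circ> transpose 1 2)" for b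
    using triangle_transpose[OF that] by (simp add: comp_assoc)
  show "(a, a \<circ> transpose 1 2) \<in> godan_rel n" for a
    by (rule godan_relI) (simp add: godan_gens_def)
qed (simp_all add: sym_godan_rel complete_on_triangle comp_assoc)

text \<open>Two disjoint triangles fill a set of \<open>fact 3 = 6\<close> elements.\<close>

lemma coset_3_eq:
  assumes \<tau>: "bij \<tau>"
  shows "coset 3 \<tau> = triangle \<tau> \<union> triangle (\<tau> \<circ> transpose 1 2)"
proof (rule sym, rule card_subset_eq)
  interpret prism "godan_rel 3" "triangle \<tau>" "triangle (\<tau> \<circ> transpose 1 2)" "\<lambda>u. u \<circ> transpose 1 2"
    using \<tau> by (rule coset_prism)
  show "finite (coset 3 \<tau>)"
    using \<tau> by (rule finite_coset)
  have "coset 3 (\<tau> \<circ> transpose 1 2) = coset 3 \<tau>"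
    by (auto simp: coset_def transpose_def)
  moreover have "bij (\<tau> \<circ> transpose 1 2)"
    using \<tau> by (intro bij_comp) auto
  ultimately show "triangle \<tau> \<union> triangle (\<tau> \<circ> transpose 1 2) \<subseteq> coset 3 \<tau>"
    using triangle_subset_coset \<tau> by blast
  have "fact 3 = (6::nat)"
    by (simp add: numeral_3_eq_3)
  then show "card (triangle \<tau> \<union> triangle (\<tau> \<circ> transpose 1 2)) = card (coset 3 \<tau>)"
    using card_A card_B disj finite \<tau> by (simp add: card_Un_disjoint card_coset)
qed

text \<open>Both properties are proved together because the packing in dimension
  \<open>k + 1\<close> draws on the connectivity of the parts. The relation stays that of dimension
  \<open>n\<close> while the coset grows.\<close>

lemma coset_connected_and_packing:
  assumes "3 \<le> m" "m \<le> n" "bij \<tau>"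
  shows "k_connected (godan_rel n) (coset m \<tau>) m \<and>
    (\<forall>S. S \<subseteq> coset m \<tau> \<longrightarrow> card S = 3 \<longrightarrow> packing (godan_rel n) (coset m \<tau>) S (m - 1))"
  using assms
proof (induction m arbitrary: \<tau> rule: dec_induct)
  case base
  interpret prism "godan_rel n" "triangle \<tau>" "triangle (\<tau> \<circ> transpose 1 2)" "\<lambda>u. u \<circ> transpose 1 2"
    using base(2) by (rule coset_prism)
  show ?case
    using connected packing coset_3_eq[OF base(2)] by simp
next
  case (step k)
  let ?V = "\<lambda>c. {u \<in> coset (Suc k) \<tau>. u (Suc k) = c}"
  have IH: "k_connected (godan_rel n) (coset k u) k"
    "\<And>S. S \<subseteq> coset k u \<Longrightarrow> card S = 3 \<Longrightarrow> packing (godan_rel n) (coset k u) S (k - 1)" if "bij u" for u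
    using step that by auto
  interpret clusters "godan_rel n" "\<tau> ` {1..Suc k}" ?V "\<lambda>u. u \<circ> (transpose 1 2 \<circ> transpose 3 (Suc k))" k
    using step IH(1) by (intro godan_clusters) auto
  have union: "\<Union>(?V ` (\<tau> ` {1..Suc k})) = coset (Suc k) \<tau>"
  proof
    show "coset (Suc k) \<tau> \<subseteq> \<Union>(?V ` (\<tau> ` {1..Suc k}))"
      using coset_value[OF _ step(5), of _ "Suc k" "Suc k"] by fastforce
  qed auto
  have "packing (godan_rel n) (coset (Suc k) \<tau>) S k" if S: "S \<subseteq> coset (Suc k) \<tau>" "card S = 3" for S
  proof -
    have "packing (godan_rel n) (?V c) S (k - 1)" if c: "S \<subseteq> ?V c" for c
    proof -
      have "S \<noteq> {}"
        using S(2) by auto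
      then obtain u where "u \<in> coset (Suc k) \<tau>" "u (Suc k) = c"
        using c by blast
      then have "bij u" "?V c = coset k u"
        using subcoset_eq[of u k \<tau>] coset_bij by auto
      then show ?thesis
        using IH(2)[of u S] c S(2) by simp
    qed
    then show ?thesis
      using packing_union[of S] S union by simp
  qed
  then show ?case
    using union_connected union by simp
qed


section \<open>Packings and trees\<close>

lemma conn_rtrancl:
  assumes "conn R W" "u \<in> W" "v \<in> W"
  shows "(u, v) \<in> R\<^sup>*"
proof (rule ccontr)
  assume neg: "(u, v) \<notin> R\<^sup>*"
  let ?D = "{w. (u, w) \<in> R\<^sup>*}"
  have "\<exists>a\<in>?D \<inter> W. \<exists>b\<in>W - ?D. (a, b) \<in> R"
    by (rule connD[OF assms(1)]) (use assms(2,3) neg in auto)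
  then show False
    by (auto intro: rtrancl_into_rtrancl)
qed

lemma connected_graph_cut:
  assumes "connected_graph T" "x \<in> uverts T" "z \<in> uverts T" "x \<in> D" "z \<notin> D"
  shows "\<exists>u\<in>D. \<exists>v. v \<notin> D \<and> {u, v} \<in> uedges T"
proof -
  have "(x, z) \<in> (adj_rel T)\<^sup>*"
    using assms unfolding connected_graph_def by blast
  then have "z \<in> D \<or> ?thesis"
    by (induction rule: rtrancl_induct) (use assms(4) in \<open>auto simp: adj_rel_def\<close>)
  then show ?thesis
    using assms(5) by blast
qed

text \<open>If the closing edge were the only one to cross the cut, membership in \<open>D\<close>
  would be constant along the list from \<open>hd c\<close> to \<open>last c\<close>.\<close>

lemma cycle_edge_redundant:
  assumes "is_cycle T c" "hd c \<in> D \<longleftrightarrow> last c \<notin> D"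
  obtains i where "Suc i < length c" "c ! i \<in> D \<longleftrightarrow> c ! Suc i \<notin> D"
    "{c ! i, c ! Suc i} \<noteq> {last c, hd c}"
proof -
  have c: "3 \<le> length c" "distinct c"
    using assms(1) by (auto simp: is_cycle_def)
  then have "c \<noteq> []" by auto
  then have ends: "hd c = c ! 0" "last c = c ! (length c - 1)"
    by (simp_all add: hd_conv_nth last_conv_nth)
  have "\<exists>i. Suc i < length c \<and> (c ! i \<in> D \<longleftrightarrow> c ! Suc i \<notin> D)"
  proof (rule ccontr)
    assume neg: "\<not> ?thesis"
    have "i < length c \<Longrightarrow> c ! i \<in> D \<longleftrightarrow> c ! 0 \<in> D" for i
      by (induction i) (use neg in auto)
    from this[of "length c - 1"] show False
      using assms(2) ends c(1) by simp
  qed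
  then obtain i where i: "Suc i < length c" "c ! i \<in> D \<longleftrightarrow> c ! Suc i \<notin> D" by blast
  \<comment> \<open>Distinctness turns equal vertices into equal indices, so equal edges could occur
    only in a list of length two.\<close>
  have "{c ! i, c ! Suc i} \<noteq> {last c, hd c}"
  proof
    assume "{c ! i, c ! Suc i} = {last c, hd c}"
    then consider "c ! i = c ! 0" "c ! Suc i = c ! (length c - 1)" | "c ! Suc i = c ! 0"
      unfolding ends by (auto simp: doubleton_eq_iff)
    then show False
    proof cases
      case 1
      then have "i = 0" "Suc i = length c - 1"
        using i(1) \<open>c \<noteq> []\<close> nth_eq_iff_index_eq[OF c(2), of i 0] nth_eq_iff_index_eq[OF c(2), of "Suc i" "length c - 1"]
        by simp_all
      then show False
        using c(1) by simp
    next
      case 2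
      then show False
        using i(1) \<open>c \<noteq> []\<close> nth_eq_iff_index_eq[OF c(2), of "Suc i" 0] by simp
    qed
  qed
  then show thesis
    using that i by blast
qed

text \<open>A smallest edge set connecting \<open>W\<close> has no cycle: the closing edge could be
  dropped, because any cut it crosses is crossed by another edge of the cycle.\<close>

lemma spanning_tree:
  assumes W: "finite W" and R: "conn R W" "R \<subseteq> W \<times> W" "\<And>u. (u, u) \<notin> R"
  obtains F where "F \<subseteq> {{u, v} | u v. (u, v) \<in> R}" "is_tree \<lparr>uverts = W, uedges = F\<rparr>"
proof -
  let ?E = "{{u, v} | u v. (u, v) \<in> R}"
  let ?rel = "\<lambda>F. {(u, v). {u, v} \<in> F}"
  let ?P = "\<lambda>F. F \<subseteq> ?E \<and> conn (?rel F) W"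
  have "finite ?E"
    by (rule finite_subset[of _ "Pow W"]) (use W R(2) in auto)
  have "?P ?E"
    using conn_mono[OF R(1), of "?rel ?E"] by blast
  then obtain F where F: "F \<subseteq> ?E" "conn (?rel F) W" and least: "\<And>F'. ?P F' \<Longrightarrow> card F \<le> card F'"
    using ex_has_least_nat[of ?P ?E card] by blast
  have finF: "finite F"
    using F(1) \<open>finite ?E\<close> by (rule finite_subset)
  let ?T = "\<lparr>uverts = W, uedges = F\<rparr>"
  have FW: "u \<in> W \<and> v \<in> W" if "{u, v} \<in> F" for u v
  proof -
    have "{u, v} \<in> ?E" using that F(1) by blast
    then show ?thesis using R(2) by (auto simp: doubleton_eq_iff)
  qed
  have "simple_graph ?T"
    unfolding simple_graph_def
  proof
    fix e assume "e \<in> uedges ?T"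
    then obtain u v where "e = {u, v}" "(u, v) \<in> R"
      using F(1) by auto
    then have "u \<noteq> v" "u \<in> W" "v \<in> W"
      using R(2,3) by blast+
    then show "\<exists>u v. e = {u, v} \<and> u \<noteq> v \<and> u \<in> uverts ?T \<and> v \<in> uverts ?T"
      using \<open>e = {u, v}\<close> by auto
  qed
  moreover have "connected_graph ?T"
    unfolding connected_graph_def adj_rel_def
    using conn_rtrancl[OF F(2)] conn_nonempty[OF F(2)] by simp
  moreover have "\<not> is_cycle ?T c" for c
  proof
    assume c: "is_cycle ?T c"
    let ?e = "{last c, hd c}"
    have e: "?e \<in> F" and ce: "\<And>i. Suc i < length c \<Longrightarrow> {c ! i, c ! Suc i} \<in> F"
      using c by (auto simp: is_cycle_def)
    have "conn (?rel (F - {?e})) W"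
    proof (rule connI)
      show "W \<noteq> {}" using conn_nonempty[OF F(2)] .
      fix D assume D: "D \<subseteq> W" "D \<noteq> {}" "D \<noteq> W"
      have "\<exists>u\<in>D \<inter> W. \<exists>v\<in>W - D. (u, v) \<in> ?rel F"
        by (rule connD[OF F(2)]) (use D in auto)
      then obtain u v where uv: "u \<in> D" "v \<in> W - D" "{u, v} \<in> F" by blast
      show "\<exists>u\<in>D. \<exists>v\<in>W - D. (u, v) \<in> ?rel (F - {?e})"
      proof (cases "{u, v} = ?e")
        case False
        then show ?thesis using uv by blast
      next
        case True
        then have "hd c \<in> D \<longleftrightarrow> last c \<notin> D"
          using uv by (auto simp: doubleton_eq_iff)
        then obtain i where i: "Suc i < length c" "c ! i \<in> D \<longleftrightarrow> c ! Suc i \<notin> D"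
          "{c ! i, c ! Suc i} \<noteq> ?e"
          using cycle_edge_redundant[OF c] by blast
        have "{c ! i, c ! Suc i} \<in> F - {?e}" "{c ! Suc i, c ! i} \<in> F - {?e}"
          using ce[OF i(1)] i(3) by (auto simp: insert_commute)
        moreover have "c ! i \<in> W" "c ! Suc i \<in> W"
          using FW[OF ce[OF i(1)]] by auto
        ultimately show ?thesis
          using i(2) by (cases "c ! i \<in> D") blast+
      qed
    qed
    then have "card F \<le> card (F - {?e})"
      using F(1) by (intro least) blast
    then show False
      using card_Diff1_less[OF finF e] by linarith
  qed
  ultimately show thesis
    using that F(1) unfolding is_tree_def by blast
qed

text \<open>Spanning trees keep the vertex sets and only lose edges, so the disjointness conditions
  carry over.\<close>

lemma packing_imp_S_trees:
  assumes fin: "finite (uverts G)"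
    and E: "\<And>u v. u \<in> uverts G \<Longrightarrow> v \<in> uverts G \<Longrightarrow> (u, v) \<in> E \<Longrightarrow> u \<noteq> v \<and> {u, v} \<in> uedges G"
    and pack: "packing E (uverts G) S r"
  shows "r \<in> S_tree_packing_sizes G S"
proof -
  obtain W R
    where WR: "\<forall>i<r. S \<subseteq> W i \<and> W i \<subseteq> uverts G \<and> R i \<subseteq> E \<inter> W i \<times> W i \<and> sym (R i) \<and> conn (R i) (W i)"
      "\<forall>i<r. \<forall>j<r. i \<noteq> j \<longrightarrow> W i \<inter> W j = S \<and> R i \<inter> R j = {}"
    using pack unfolding packing_def by (elim exE conjE) (rule that)
  have "\<exists>F. F \<subseteq> {{u, v} | u v. (u, v) \<in> R i} \<and> is_tree \<lparr>uverts = W i, uedges = F\<rparr>" if "i < r" for i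
  proof -
    have Wi: "W i \<subseteq> uverts G" "R i \<subseteq> E \<inter> W i \<times> W i" "conn (R i) (W i)"
      using WR(1) that by auto
    have fin_Wi: "finite (W i)"
      using Wi(1) fin by (rule finite_subset)
    have RW: "R i \<subseteq> W i \<times> W i"
      using Wi(2) by blast
    have irrefl: "(u, u) \<notin> R i" for u
      using Wi(1,2) E[of u u] by blast
    obtain F where "F \<subseteq> {{u, v} | u v. (u, v) \<in> R i}" "is_tree \<lparr>uverts = W i, uedges = F\<rparr>"
      by (rule spanning_tree[OF fin_Wi Wi(3) RW irrefl])
    then show ?thesis
      by blast
  qed
  then have "\<exists>F. \<forall>i. i < r \<longrightarrow> F i \<subseteq> {{u, v} | u v. (u, v) \<in> R i} \<and> is_tree \<lparr>uverts = W i, uedges = F i\<rparr>"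
    by (intro choice allI) blast
  then obtain F
    where FT: "\<forall>i. i < r \<longrightarrow> F i \<subseteq> {{u, v} | u v. (u, v) \<in> R i} \<and> is_tree \<lparr>uverts = W i, uedges = F i\<rparr>"
    by (rule exE)
  have F: "F i \<subseteq> {{u, v} | u v. (u, v) \<in> R i}" "is_tree \<lparr>uverts = W i, uedges = F i\<rparr>" if "i < r" for i
    using FT[rule_format, OF that] by (rule conjunct1, rule conjunct2)
  define T where "T i = \<lparr>uverts = W i, uedges = F i\<rparr>" for i
  have "S_tree G S (T i)" if i: "i < r" for i
  proof -
    have "F i \<subseteq> uedges G"
    proof
      fix e assume "e \<in> F i"
      then obtain u v where "e = {u, v}" "(u, v) \<in> R i"
        using F(1)[OF i] by blast
      then show "e \<in> uedges G"
        using E[of u v] WR(1) i by blast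
    qed
    then show ?thesis
      using F(2)[OF i] WR(1) i
      unfolding S_tree_def is_subgraph_def T_def by (auto simp: is_tree_def)
  qed
  moreover have "internally_edge_disjoint S r T"
    unfolding internally_edge_disjoint_def
  proof (intro allI impI conjI)
    fix i j assume ij: "i < r" "j < r" "i \<noteq> j"
    show "uverts (T i) \<inter> uverts (T j) = S"
      using WR(2) ij by (simp add: T_def)
    show "uedges (T i) \<inter> uedges (T j) = {}"
    proof (rule ccontr)
      assume "uedges (T i) \<inter> uedges (T j) \<noteq> {}"
      then obtain e where e: "e \<in> F i" "e \<in> F j" by (auto simp: T_def)
      obtain u v where uv: "e = {u, v}" "(u, v) \<in> R i"
        using subsetD[OF F(1)[OF ij(1)] e(1)] by blast
      obtain u' v' where uv': "e = {u', v'}" "(u', v') \<in> R j"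
        using subsetD[OF F(1)[OF ij(2)] e(2)] by blast
      \<comment> \<open>A common unordered edge might come from \<open>(u, v)\<close> in
        \<open>R i\<close> and from \<open>(v, u)\<close> in \<open>R j\<close>; symmetry brings
        both to the same pair.\<close>
      have "sym (R j)"
        using WR(1) ij by blast
      then have "(u, v) \<in> R j"
        using uv uv' by (auto simp: doubleton_eq_iff dest: symD)
      then show False
        using uv(2) WR(2) ij by blast
    qed
  qed
  ultimately show ?thesis
    unfolding S_tree_packing_sizes_def by blast
qed

text \<open>If there were as many trees as edges at \<open>x\<close> and at \<open>y\<close>, every tree would use exactly one edge
  at each of them, and the tree containing the edge \<open>xy\<close> could not reach \<open>z\<close>.\<close>

lemma S_tree_packing_less_degree:
  assumes r: "r \<in> S_tree_packing_sizes G S" and S: "x \<in> S" "y \<in> S" "z \<in> S" "x \<noteq> z" "y \<noteq> z"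
    and xy: "x \<noteq> y" "{x, y} \<in> uedges G"
    and deg: "\<And>w. w \<in> {x, y} \<Longrightarrow> finite {e \<in> uedges G. w \<in> e} \<and> card {e \<in> uedges G. w \<in> e} \<le> d"
  shows "r < d"
proof (rule ccontr)
  assume "\<not> r < d"
  obtain T where T: "\<And>i. i < r \<Longrightarrow> S_tree G S (T i)" and disj: "internally_edge_disjoint S r T"
    using r by (auto simp: S_tree_packing_sizes_def)
  have conn: "connected_graph (T i)" "S \<subseteq> uverts (T i)" "uedges (T i) \<subseteq> uedges G" if "i < r" for i
    using T[OF that] by (auto simp: S_tree_def is_tree_def is_subgraph_def)
  have edge_unique: "i = j" if "i < r" "j < r" "e \<in> uedges (T i)" "e \<in> uedges (T j)" for i j e
    using disj that unfolding internally_edge_disjoint_def by blast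
  \<comment> \<open>At least \<open>d\<close> trees each take an edge at \<open>w\<close>, so the
    injective choice \<open>g\<close> exhausts the edges at \<open>w\<close>. Hence each edge at
    \<open>w\<close> belongs to some tree and is the only edge of that tree at
    \<open>w\<close>.\<close>
  have one: "(\<exists>i<r. e \<in> uedges (T i)) \<and> (\<forall>i<r. \<forall>e'. e \<in> uedges (T i) \<longrightarrow> w \<in> e' \<longrightarrow> e' \<in> uedges (T i) \<longrightarrow> e' = e)"
    if w: "w \<in> {x, y}" and e: "e \<in> uedges G" "w \<in> e" for w e
  proof -
    let ?D = "{e \<in> uedges G. w \<in> e}"
    have "\<exists>e. w \<in> e \<and> e \<in> uedges (T i)" if "i < r" for i
      using connected_graph_cut[OF conn(1)[OF that], of w z "{w}"] conn(2)[OF that] w S by blast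
    then obtain g where g: "\<And>i. i < r \<Longrightarrow> w \<in> g i \<and> g i \<in> uedges (T i)"
      by metis
    have inj: "inj_on g {..<r}"
      using g edge_unique by (intro inj_onI) (metis lessThan_iff)
    have sub: "g ` {..<r} \<subseteq> ?D"
      using g conn(3) by blast
    have "card ?D \<le> card (g ` {..<r})"
      using deg[OF w] \<open>\<not> r < d\<close> by (simp add: card_image[OF inj])
    then have img: "g ` {..<r} = ?D"
      using card_seteq[OF _ sub] deg[OF w] by blast
    have own: "e' = g i" if "i < r" "w \<in> e'" "e' \<in> uedges (T i)" for i e'
    proof -
      have "e' \<in> ?D"
        using that conn(3) by blast
      then obtain j where j: "j < r" "e' = g j"
        using img by blast
      then show ?thesis
        using edge_unique[OF that(1) j(1) that(3)] g[OF j(1)] by simp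
    qed
    have "e \<in> g ` {..<r}"
      using img e by blast
    then show ?thesis
      using own g e(2) by blast
  qed
  obtain i where i: "i < r" "{x, y} \<in> uedges (T i)"
    using one[of x "{x, y}"] xy(2) by blast
  have only: "e = {x, y}" if "e \<in> uedges (T i)" "x \<in> e \<or> y \<in> e" for e
    using that one[of x "{x, y}"] one[of y "{x, y}"] xy(2) i by blast
  have "\<exists>u\<in>{x, y}. \<exists>v. v \<notin> {x, y} \<and> {u, v} \<in> uedges (T i)"
    by (rule connected_graph_cut[OF conn(1)[OF i(1)], of x z]) (use conn(2)[OF i(1)] S in auto)
  then obtain u v where "u \<in> {x, y}" "v \<notin> {x, y}" "{u, v} \<in> uedges (T i)" by blast
  then show False
    using only[of "{u, v}"] by auto
qed


section \<open>The degree of the godan graph and the two bounds combined\<close>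

lemma card_godan_gens:
  assumes "3 \<le> n"
  shows "finite (godan_gens n)" "card (godan_gens n) \<le> n"
proof -
  let ?A = "{transpose 1 2, cycle_of_list [1, 2, 3], cycle_of_list [1, 3, 2]} :: (nat \<Rightarrow> nat) set"
  let ?B = "(\<lambda>i. transpose 1 2 \<circ> transpose 3 i) ` {4..n} :: (nat \<Rightarrow> nat) set"
  have eq: "godan_gens n = ?A \<union> ?B"
    unfolding godan_gens_def by (simp only: setcompr_eq_image) auto
  show "finite (godan_gens n)"
    unfolding eq by simp
  have "card (godan_gens n) \<le> card ?A + card ?B"
    unfolding eq by (rule card_Un_le)
  also have "\<dots> \<le> 3 + card {4..n}"
    by (intro add_mono card_image_le) (simp_all add: card_insert_if)
  finally show "card (godan_gens n) \<le> n"
    using assms by simp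
qed

lemma uverts_godan: "uverts (godan_graph n) = {p. p permutes {1..n}}"
  by (simp add: godan_graph_def cayley_graph_def sym_group_def)

lemma finite_uedges_godan: "finite (uedges (godan_graph n))"
proof (rule finite_subset)
  show "uedges (godan_graph n) \<subseteq> Pow (uverts (godan_graph n))"
  proof
    fix e assume "e \<in> uedges (godan_graph n)"
    then obtain u v where "e = {u, v}" "u \<in> uverts (godan_graph n)" "v \<in> uverts (godan_graph n)"
      using simple_graph_godan[of n] unfolding simple_graph_def by blast
    then show "e \<in> Pow (uverts (godan_graph n))"
      by simp
  qed
  show "finite (Pow (uverts (godan_graph n)))"
    by (simp add: uverts_godan finite_permutations)
qed

lemma godan_degree:
  assumes n: "3 \<le> n" and w: "w permutes {1..n}"
  shows "card {e \<in> uedges (godan_graph n). w \<in> e} \<le> n"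
proof -
  have "{e \<in> uedges (godan_graph n). w \<in> e} \<subseteq> (\<lambda>s. {w \<circ> s, w}) ` godan_gens n"
  proof
    fix e assume "e \<in> {e \<in> uedges (godan_graph n). w \<in> e}"
    then have e: "e \<in> uedges (godan_graph n)" "w \<in> e" by auto
    then obtain u v where "e = {u, v}" "u \<in> uverts (godan_graph n)" "v \<in> uverts (godan_graph n)"
      using simple_graph_godan[of n] unfolding simple_graph_def by blast
    with e(2) obtain v where v: "e = {v, w}" "v permutes {1..n}"
      unfolding uverts_godan by auto
    then show "e \<in> (\<lambda>s. {w \<circ> s, w}) ` godan_gens n"
      using godan_graph_adjacent_iff[OF v(2) w] e(1) by auto
  qed
  then have "card {e \<in> uedges (godan_graph n). w \<in> e} \<le> card ((\<lambda>s. {w \<circ> s, w}) ` godan_gens n)"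
    using card_godan_gens(1)[OF n] by (intro card_mono) auto
  also have "\<dots> \<le> card (godan_gens n)"
    using card_godan_gens(1)[OF n] by (rule card_image_le)
  finally show ?thesis
    using card_godan_gens(2)[OF n] by simp
qed

lemma godan_packing:
  assumes n: "3 \<le> n" and S: "S \<subseteq> uverts (godan_graph n)" "card S = 3"
  shows "n - 1 \<in> S_tree_packing_sizes (godan_graph n) S"
proof (rule packing_imp_S_trees)
  show "finite (uverts (godan_graph n))"
    by (simp add: uverts_godan finite_permutations)
  have eq: "uverts (godan_graph n) = coset n id"
    by (simp only: uverts_godan coset_id)
  show "packing (godan_rel n) (uverts (godan_graph n)) S (n - 1)"
    using coset_connected_and_packing[OF n order_refl bij_id] S unfolding eq by blast
  fix u v assume uv: "u \<in> uverts (godan_graph n)" "v \<in> uverts (godan_graph n)" "(u, v) \<in> godan_rel n"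
  then have p: "u permutes {1..n}" "v permutes {1..n}"
    by (auto simp: uverts_godan)
  obtain s where "s \<in> godan_gens n" "v = u \<circ> s"
    using uv(3) unfolding godan_rel_def by blast
  then have e: "{u, v} \<in> uedges (godan_graph n)"
    using godan_graph_adjacent_iff[OF p(2,1)] by (auto simp: insert_commute)
  then show "u \<noteq> v \<and> {u, v} \<in> uedges (godan_graph n)"
    using simple_graph_godan[of n] unfolding simple_graph_def by (metis doubleton_eq_iff)
qed

theorem theorem2:
  fixes n :: nat
  assumes "n \<ge> 3"
  shows "gen_connectivity 3 (godan_graph n) = n - 1"
proof -
  let ?G = "godan_graph n"
  let ?K = "{kappa_set ?G S | S. S \<subseteq> uverts ?G \<and> card S = 3}"
  have fin: "finite (S_tree_packing_sizes ?G S)" if "card S = 3" for S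
    using that by (intro finite_S_tree_packing_sizes finite_uedges_godan) simp
  have lower: "n - 1 \<le> kappa_set ?G S" if "S \<subseteq> uverts ?G" "card S = 3" for S
    unfolding kappa_set_def using fin godan_packing[OF assms] that by (intro Max_ge) auto
  \<comment> \<open>\<open>id\<close> and \<open>(12)\<close> are adjacent, as the degree argument
    requires, and \<open>(13)\<close> is an arbitrary third vertex; the values at 1 tell the three
    apart.\<close>
  let ?x = "id :: nat \<Rightarrow> nat" and ?y = "transpose 1 2 :: nat \<Rightarrow> nat" and ?z = "transpose 1 3 :: nat \<Rightarrow> nat"
  have perms: "?x permutes {1..n}" "?y permutes {1..n}" "?z permutes {1..n}"
    using assms by (auto intro: permutes_id permutes_swap_id)
  have "?x 1 = 1" "?y 1 = 2" "?z 1 = 3"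
    by (simp_all add: transpose_def)
  then have distinct: "?x \<noteq> ?y" "?x \<noteq> ?z" "?y \<noteq> ?z"
    by (metis numeral_eq_iff one_eq_numeral_iff semiring_norm)+
  let ?S = "{?x, ?y, ?z}"
  have S: "?S \<subseteq> uverts ?G" "card ?S = 3"
    using perms distinct by (auto simp: uverts_godan)
  have edge: "{?x, ?y} \<in> uedges ?G"
    using godan_graph_adjacent_iff[OF perms(2,1)] by (auto simp: godan_gens_def insert_commute)
  have "r \<le> n - 1" if "r \<in> S_tree_packing_sizes ?G ?S" for r
  proof -
    have "r < n"
      by (rule S_tree_packing_less_degree[OF that, of ?x ?y ?z])
        (use edge distinct perms godan_degree[OF assms] finite_uedges_godan[of n] in auto)
    then show ?thesis by simp
  qed
  then have "kappa_set ?G ?S = n - 1"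
    unfolding kappa_set_def using godan_packing[OF assms S] fin[OF S(2)] by (intro Max_eqI) auto
  then have mem: "n - 1 \<in> ?K"
    using S by (intro CollectI exI[of _ ?S]) simp
  have "finite (uverts ?G)"
    by (simp add: uverts_godan finite_permutations)
  then have "finite (kappa_set ?G ` Pow (uverts ?G))"
    by simp
  then have "finite ?K"
    by (rule finite_subset[rotated]) auto
  then show ?thesis
    unfolding gen_connectivity_def using mem lower by (intro Min_eqI) auto
qed

end
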